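(* Let $F$ and $G$ be continuous cumulative distribution functions on $\mathbb{R}$. Let $X_1,\dots,X_n$ be i.i.d. with distribution function $F$ and $Y_1,\dots,Y_m$ be i.i.d. with distribution function $G$ ($n,m\ge1$), the two samples being independent of each other, with empirical distribution functions $F_n$ and $G_m$. Then for all $z\ge\sqrt{\log(2)/2}\,\bigl(n^{-1/2}+m^{-1/2}\bigr)$, $$\mathrm{Prob}\Big[|d(F_n,G_m)-d(F,G)|>z\Big]\ \le\ \min\bigl\{1,\ C(n,m,z)+C(m,n,z)\bigr\},$$ where $$C(n,m,z):=\left(1+\frac{n}{m+n}\right)2^{-\frac{m}{n}}\,e^{-2mz\left(z-\sqrt{\frac{\log 4}{n}}\right)}+\sqrt{8\pi}\,z\,\frac{mn}{(m+n)^{3/2}}\,e^{-\frac{2mnz^2}{m+n}}\,\mathrm{erf}\left(\sqrt{\frac{2m^2z^2}{m+n}}-\sqrt{\frac{(m+n)\log 2}{n}}\right).$$ For $n=m$, $$\mathrm{Prob}\left[\sqrt{\frac{n}{2}}\,|d(F_n,G_n)-d(F,G)|>z\right]\ \le\ \alpha_2(z):=\min\left\{1,\ \frac32 e^{-4z\left(z-\sqrt{\log 2}\right)}+\sqrt{8\pi}\,z\,e^{-2z^2}\,\mathrm{erf}\left[\sqrt2\left(z-\sqrt{\log 2}\right)\right]\right\}$$ for all $z\ge\sqrt{\log 2}$.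
   Context: For two distribution functions $A,B$ on $\mathbb{R}$ (cumulative or empirical), the Kolmogorov-Smirnov distance is $d(A,B):=\sup_{x\in\mathbb{R}}|A(x)-B(x)|$. The empirical distribution functions are $F_n(x)=\frac1n\sum_{i=1}^n I(X_i\le x)$ and $G_m(x)=\frac1m\sum_{i=1}^m I(Y_i\le x)$, where $I$ denotes the indicator. $\log$ is the natural logarithm and $\mathrm{erf}(t)=\frac{2}{\sqrt\pi}\int_0^t e^{-s^2}\,ds$ (an odd function, defined for all real $t$). *)

theory Defs
  imports "HOL-Probability.Probability"
begin

definition is_cdf :: "(real \<Rightarrow> real) \<Rightarrow> bool" where
  "is_cdf F \<longleftrightarrow> (\<exists>\<mu>. real_distribution \<mu> \<and> F = cdf \<mu>)"

definition ecdf :: "nat \<Rightarrow> (nat \<Rightarrow> real) \<Rightarrow> real \<Rightarrow> real" where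
  "ecdf n xs x = 1 / real n * (\<Sum>i=1..n. of_bool (xs i \<le> x))"

definition ks_dist :: "(real \<Rightarrow> real) \<Rightarrow> (real \<Rightarrow> real) \<Rightarrow> real" where
  "ks_dist A B = (SUP x. \<bar>A x - B x\<bar>)"

(* The interval integral is oriented, so this is odd and also right for negative t. *)
definition erf :: "real \<Rightarrow> real" where
  "erf t = 2 / sqrt pi * (LBINT s=0..t. exp (- s\<^sup>2))"

definition iid_sample ::
    "'a measure \<Rightarrow> nat \<Rightarrow> (nat \<Rightarrow> 'a \<Rightarrow> real) \<Rightarrow> (real \<Rightarrow> real) \<Rightarrow> bool" where
  "iid_sample M n X F \<longleftrightarrow>
     prob_space.indep_vars M (\<lambda>_. borel) X {1..n} \<and>
     (\<forall>i\<in>{1..n}. cdf (distr M borel (X i)) = F)"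

(* Independence of the random vectors (X 1, ..., X n) and (Y 1, ..., Y m). *)
definition indep_samples ::
    "'a measure \<Rightarrow> nat \<Rightarrow> (nat \<Rightarrow> 'a \<Rightarrow> real) \<Rightarrow> nat \<Rightarrow> (nat \<Rightarrow> 'a \<Rightarrow> real) \<Rightarrow> bool" where
  "indep_samples M n X m Y \<longleftrightarrow>
     prob_space.indep_var M
       (\<Pi>\<^sub>M i\<in>{1..n}. borel) (\<lambda>\<omega>. \<lambda>i\<in>{1..n}. X i \<omega>)
       (\<Pi>\<^sub>M j\<in>{1..m}. borel) (\<lambda>\<omega>. \<lambda>j\<in>{1..m}. Y j \<omega>)"

definition C :: "nat \<Rightarrow> nat \<Rightarrow> real \<Rightarrow> real" where
  "C n m z =
     (1 + real n / (real m + real n)) * 2 powr (- (real m / real n)) *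
       exp (- 2 * real m * z * (z - sqrt (ln 4 / real n)))
     + sqrt (8 * pi) * z * (real m * real n / (real m + real n) powr (3 / 2)) *
       exp (- (2 * real m * real n * z\<^sup>2 / (real m + real n))) *
       erf (sqrt (2 * (real m)\<^sup>2 * z\<^sup>2 / (real m + real n))
            - sqrt ((real m + real n) * ln 2 / real n))"

definition \<alpha>\<^sub>2 :: "real \<Rightarrow> real" where
  "\<alpha>\<^sub>2 z = min 1
     (3 / 2 * exp (- 4 * z * (z - sqrt (ln 2)))
      + sqrt (8 * pi) * z * exp (- 2 * z\<^sup>2) * erf (sqrt 2 * (z - sqrt (ln 2))))"

end

(*
Writing U = (F_n - F) - (G_m - G), the difference of the two distances is at most sup |U|, and
sup |U| is at most the larger of sup (F_n - F)^+ + sup (G - G_m)^+ and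
sup (F - F_n)^+ + sup (G_m - G)^+.  Only one-sided deviations of independent samples are added,
which is what makes the constants half of those that two-sided tail bounds would give.

The one-sided deviations satisfy P(sup (F_n - F) > s) <= exp(-2 n s^2) for every s >= 0.  After
the probability integral transform F is uniform.  Let f_k(x) be the volume of the points of
[0,x]^k whose counting function exceeds the line n (s + t) at some t.  Conditioning on the largest
point gives f_k' <= k f_(k-1), so K (x + w)^k dominates f_k as soon as it dominates x^k at
x = k/n - s, where the line reaches level k.  Choosing w at a saddle point turns the final bound
K (1 + w)^n into exp(-n KL(t + s, t)) for Bernoulli parameters t + s and t, and Pinsker's
inequality bounds KL from below by 2 s^2.

Convolving these tails, each used only where it is at most 1/2 and replaced by 1 elsewhere, gives
(C(n,m,z) + C(m,n,z)) / 2 for each of the two sums.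
*)
theory Submission
  imports Defs
begin

section \<open>A saddle point inequality\<close>

text \<open>Both sides agree at 0 and their difference has a nonnegative derivative. This [1/1] Pade
  bound is what makes the function \<open>h\<close> in \<open>dkw_saddle\<close> monotone.\<close>

lemma ln_add_one_ge_rational:
  fixes v :: real assumes "0 \<le> v" shows "2 * v / (2 + v) \<le> ln (1 + v)"
proof -
  have "((\<lambda>v. ln (1 + v) - 2 * v / (2 + v)) has_real_derivative x\<^sup>2 / ((1 + x) * (2 + x)\<^sup>2)) (at x)"
    if "0 \<le> x" for x :: real
  proof (rule DERIV_cong)
    show "((\<lambda>v. ln (1 + v) - 2 * v / (2 + v)) has_real_derivative
        1 / (1 + x) - (2 * (2 + x) - 2 * x) / ((2 + x) * (2 + x))) (at x)"
      using that by (auto intro!: derivative_eq_intros)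
    have "1 + x \<noteq> 0" "2 + x \<noteq> 0" using that by auto
    then show "1 / (1 + x) - (2 * (2 + x) - 2 * x) / ((2 + x) * (2 + x)) = x\<^sup>2 / ((1 + x) * (2 + x)\<^sup>2)"
      by (simp add: divide_simps power2_eq_square) (simp add: algebra_simps)?
  qed
  then have "ln (1 + 0) - 2 * 0 / (2 + 0) \<le> ln (1 + v) - 2 * v / (2 + v)"
    using assms
    by (intro deriv_nonneg_imp_mono[where g = "\<lambda>v. ln (1 + v) - 2 * v / (2 + v)"]) auto
  then show ?thesis by simp
qed

text \<open>With \<open>q\<close> fixed, \<open>f x\<close> is 2 (q - x)^2 minus the divergence
  between Bernoulli \<open>q\<close> and Bernoulli \<open>x\<close>, up to a constant independent of
  \<open>x\<close>. Since x (1 - x) <= 1/4, it is nondecreasing up to \<open>q\<close>, where the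
  divergence vanishes.\<close>

lemma bernoulli_pinsker:
  fixes t q :: real
  assumes "0 < t" "t \<le> q" "q < 1"
  shows "2 * (q - t)\<^sup>2 \<le> q * ln (q / t) + (1 - q) * ln ((1 - q) / (1 - t))"
proof -
  define f where "f x = 2 * (q - x)\<^sup>2 + q * ln x + (1 - q) * ln (1 - x)" for x
  have d: "(f has_real_derivative (q - x) * (1 / (x * (1 - x)) - 4)) (at x)" if "t \<le> x" "x \<le> q" for x
  proof -
    have x: "0 < x" "x < 1" using that assms by auto
    have "(f has_real_derivative - (4 * (q - x)) + q / x - (1 - q) / (1 - x)) (at x)"
      unfolding f_def using x by (auto intro!: derivative_eq_intros)
    moreover have "q / x - (1 - q) / (1 - x) = (q - x) * (1 / (x * (1 - x)))"
      using x by (simp add: divide_simps) (simp add: algebra_simps)?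
    ultimately show ?thesis by (simp add: algebra_simps)
  qed
  have "0 \<le> (q - x) * (1 / (x * (1 - x)) - 4)" if "t \<le> x" "x \<le> q" for x
  proof -
    have x: "0 < x" "x < 1" using that assms by auto
    have "0 \<le> (1 - 2 * x)\<^sup>2" by simp
    then have "4 * (x * (1 - x)) \<le> 1" by (simp add: power2_eq_square algebra_simps)
    then have "4 \<le> 1 / (x * (1 - x))" using x by (simp add: field_simps)
    then show ?thesis using that by simp
  qed
  then have "f t \<le> f q" using d assms
    by (intro DERIV_nonneg_imp_nondecreasing[of t q f]) (assumption, blast)
  moreover have "ln (q / t) = ln q - ln t" "ln ((1 - q) / (1 - t)) = ln (1 - q) - ln (1 - t)"
    using assms by (auto simp: ln_div)
  ultimately show ?thesis by (simp only: f_def) (simp add: algebra_simps)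
qed

text \<open>The equation says that the derivative in \<open>t\<close> of the divergence between
  Bernoulli \<open>t + e\<close> and Bernoulli \<open>t\<close> is zero. That derivative is at most
  0 at the symmetric point and at least 0 close to \<open>1 - e\<close>, where the logarithm is
  large.\<close>

lemma stationary_point_exists:
  fixes e :: real
  assumes "0 < e" "e < 1"
  obtains t where "0 < t" "t < 1 - e"
    "ln ((t + e) * (1 - t) / ((1 - t - e) * t)) = e / (t * (1 - t))"
proof -
  define D where "D t = ln ((t + e) * (1 - t) / ((1 - t - e) * t)) - e / (t * (1 - t))" for t
  \<comment> \<open>With \<open>b = 1 - e - s\<close> the argument of the logarithm is at least
    (e/2) / s = exp (2 / (1 - e)), while e / (b (1 - b)) is at most 2 / (1 - e); hence
    \<open>D b\<close> is nonnegative.\<close>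
  define s where "s = e / 2 * exp (- (2 / (1 - e)))"
  have s0: "0 < s" using assms by (simp add: s_def)
  have "exp (- (2 / (1 - e))) \<le> (1 - e) / 2"
  proof -
    have "2 / (1 - e) \<le> exp (2 / (1 - e))" using exp_ge_add_one_self[of "2 / (1 - e)"] by linarith
    then show ?thesis using assms by (simp add: exp_minus field_simps)
  qed
  then have "s \<le> 1 * ((1 - e) / 2)" unfolding s_def using assms by (intro mult_mono) auto
  then have s1: "s \<le> (1 - e) / 2" by simp
  \<comment> \<open>At \<open>a\<close> one has a + e = 1 - a, so the argument of the logarithm is a
    perfect square and the sign of \<open>D a\<close> reduces to ln ((1 + e) / (1 - e)) <= 2 e / (1
    - e^2).\<close>
  define a b where "a = (1 - e) / 2" and "b = 1 - e - s"
  have "D a \<le> 0"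
  proof -
    have "(a + e) * (1 - a) / ((1 - a - e) * a) = ((1 + e) / (1 - e))\<^sup>2"
    proof -
      have "(a + e) * (1 - a) = ((1 + e) / 2)\<^sup>2" "(1 - a - e) * a = ((1 - e) / 2)\<^sup>2"
        by (simp_all add: a_def power2_eq_square field_simps)
      then have "(a + e) * (1 - a) / ((1 - a - e) * a) = ((1 + e) / 2)\<^sup>2 / ((1 - e) / 2)\<^sup>2"
        by (simp only:)
      also have "\<dots> = ((1 + e) / (1 - e))\<^sup>2" by (simp add: power_divide)
      finally show ?thesis .
    qed
    moreover have "ln (((1 + e) / (1 - e))\<^sup>2) = - 2 * ln ((1 - e) / (1 + e))"
      using assms by (simp add: ln_realpow ln_div)
    moreover have "- ln ((1 - e) / (1 + e)) \<le> 2 * e / (1 - e\<^sup>2)"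
    proof -
      define h where "h x = 2 * x / (1 - x\<^sup>2) + ln (1 - x) - ln (1 + x)" for x :: real
      have two_div_square: "2 * d / d\<^sup>2 = 2 / d" if "d \<noteq> 0" for d :: real
        using that by (simp add: power2_eq_square)
      have n: "1 - x\<^sup>2 \<noteq> 0" if "0 \<le> x" "x \<le> e" for x
        using that assms abs_square_less_1[of x] by auto
      have "(h has_real_derivative 4 * x\<^sup>2 / (1 - x\<^sup>2)\<^sup>2) (at x)" if "0 \<le> x" "x \<le> e" for x
      proof -
        have "1 / (1 - x) + 1 / (1 + x) = 2 / (1 - x\<^sup>2)"
          using that assms by (simp add: field_simps power2_eq_square)
        moreover have "2 * (1 - x\<^sup>2) / (1 - x\<^sup>2)\<^sup>2 = 2 / (1 - x\<^sup>2)"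
          using n[OF that] by (rule two_div_square)
        moreover have "(2 * (1 - x\<^sup>2) + 4 * x\<^sup>2) / (1 - x\<^sup>2)\<^sup>2 = 2 * (1 - x\<^sup>2) / (1 - x\<^sup>2)\<^sup>2 + 4 * x\<^sup>2 / (1 - x\<^sup>2)\<^sup>2"
          by (rule add_divide_distrib)
        ultimately have "(2 * (1 - x\<^sup>2) + 4 * x\<^sup>2) / (1 - x\<^sup>2)\<^sup>2 - 1 / (1 - x) - 1 / (1 + x) = 4 * x\<^sup>2 / (1 - x\<^sup>2)\<^sup>2"
          by linarith
        moreover have "(h has_real_derivative (2 * (1 - x\<^sup>2) + 4 * x\<^sup>2) / (1 - x\<^sup>2)\<^sup>2 - 1 / (1 - x) - 1 / (1 + x)) (at x)"
          unfolding h_def using that assms n[OF that]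
          by (auto intro!: derivative_eq_intros simp: power2_eq_square)
        ultimately show ?thesis by (rule DERIV_cong[rotated])
      qed
      then have "h 0 \<le> h e" using assms
        by (intro DERIV_nonneg_imp_nondecreasing[of 0 e h]) (simp, fastforce intro: divide_nonneg_nonneg)
      then show ?thesis using assms by (simp only: h_def) (simp add: ln_div)
    qed
    moreover have "e / (a * (1 - a)) = 4 * e / (1 - e\<^sup>2)"
      by (simp add: a_def field_simps power2_eq_square)
    ultimately show ?thesis by (simp only: D_def)
  qed
  moreover have "0 \<le> D b"
  proof -
    have b: "(1 - e) / 2 \<le> b" "b < 1 - e" using s0 s1 by (auto simp: b_def)
    have "e / (b * (1 - b)) \<le> e / ((1 - e) / 2 * e)"
      using b assms by (intro divide_left_mono mult_mono) auto
    also have "\<dots> = 2 / (1 - e)" using assms by simp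
    finally have 1: "e / (b * (1 - b)) \<le> 2 / (1 - e)" .
    have "exp (2 / (1 - e)) = 1/2 * e / (s * 1)"
      using assms by (simp add: s_def exp_minus inverse_eq_divide)
    also have "\<dots> \<le> (b + e) * (1 - b) / ((1 - b - e) * b)"
    proof (rule frac_le)
      show "1/2 * e \<le> (b + e) * (1 - b)" using b assms by (intro mult_mono) auto
      have "1 - b - e = s" by (simp add: b_def)
      then show "0 < (1 - b - e) * b" "(1 - b - e) * b \<le> s * 1"
        using b s0 s1 assms by simp_all
      show "0 \<le> (b + e) * (1 - b)" using b assms by simp
    qed
    finally have "exp (2 / (1 - e)) \<le> (b + e) * (1 - b) / ((1 - b - e) * b)" .
    from ln_mono[OF this exp_gt_zero]
    have "2 / (1 - e) \<le> ln ((b + e) * (1 - b) / ((1 - b - e) * b))" by (simp only: ln_exp)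
    then show ?thesis using 1 by (simp add: D_def)
  qed
  moreover have "a \<le> b" "a > 0" "b < 1 - e" using s1 s0 assms by (auto simp: a_def b_def)
  moreover have "continuous_on {a..b} D"
  proof -
    have "(t + e) * (1 - t) / ((1 - t - e) * t) \<noteq> 0 \<and> (1 - t - e) * t \<noteq> 0 \<and> t * (1 - t) \<noteq> 0"
      if "t \<in> {a..b}" for t
      using that assms \<open>a > 0\<close> \<open>b < 1 - e\<close> by simp
    then show ?thesis unfolding D_def by (intro continuous_intros) auto
  qed
  ultimately obtain t where "a \<le> t" "t \<le> b" "D t = 0" using IVT'[of D a 0 b] by blast
  then show thesis using \<open>a > 0\<close> \<open>b < 1 - e\<close> by (intro that[of t]) (auto simp: D_def)
qed

text \<open>Equality up to the gap in Pinsker's inequality holds where \<open>x\<close> is the stationary point \<open>t\<close> of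
  the divergence between Bernoulli \<open>t + e\<close> and Bernoulli \<open>t\<close>; the right-hand side is minimal there.\<close>

lemma dkw_saddle:
  fixes e :: real
  assumes e: "0 < e" "e < 1"
  obtains w where "0 < w"
    "\<And>x. 0 < x \<Longrightarrow> ln (1 + w) + 2 * e\<^sup>2 \<le> (x + e) * ln (1 + w / x)"
proof -
  obtain t where t: "0 < t" "t < 1 - e"
    and D: "ln ((t + e) * (1 - t) / ((1 - t - e) * t)) = e / (t * (1 - t))"
    using stationary_point_exists[OF e] .
  \<comment> \<open>This choice gives 1 + w = (1 - t) / (1 - t - e), so that
    \<open>S t - ln (1 + w)\<close> is exactly the divergence between Bernoulli \<open>t + e\<close>
    and Bernoulli \<open>t\<close>, and Pinsker's inequality applies.\<close>
  define w where "w = e / (1 - t - e)"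
  have w: "0 < w" using t e by (simp add: w_def)
  have 1: "1 + w = (1 - t) / (1 - t - e)" using t by (simp add: w_def divide_simps)
  have 2: "1 + w / t = (t + e) * (1 - t) / ((1 - t - e) * t)"
    using t by (simp add: w_def divide_simps) (simp add: algebra_simps)
  define S where "S x = (x + e) * ln (1 + w / x)" for x
  \<comment> \<open>\<open>h\<close> is the numerator of the derivative of \<open>S\<close>. It is
    nondecreasing, and the stationarity equation \<open>D\<close> says that it vanishes at
    \<open>t\<close>; so \<open>S\<close> decreases before \<open>t\<close> and increases after
    it.\<close>
  define h where "h x = x * (x + w) * ln (1 + w / x) - (x + e) * w" for x
  have lnderiv: "((\<lambda>x. ln (1 + w / x)) has_real_derivative - w / (x * (x + w))) (at x)" if "0 < x" for x
  proof -
    have "1 + w / x > 0" using that w by (simp add: add_pos_pos)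
    then show ?thesis using that w
      by (auto intro!: derivative_eq_intros simp: field_simps)
  qed
  have S': "(S has_real_derivative h x / (x * (x + w))) (at x)" if "0 < x" for x
  proof (rule DERIV_cong)
    show "(S has_real_derivative ln (1 + w / x) - (x + e) * (w / (x * (x + w)))) (at x)"
      unfolding S_def
      by (rule DERIV_cong[OF DERIV_mult'[OF _ lnderiv[OF that]]])
        (auto intro!: derivative_eq_intros)
    show "ln (1 + w / x) - (x + e) * (w / (x * (x + w))) = h x / (x * (x + w))"
      using that w by (simp add: h_def diff_divide_distrib)
  qed
  have h1: "(h has_real_derivative (2 * x + w) * ln (1 + w / x) - 2 * w) (at x)" if "0 < x" for x
  proof -
    have "((\<lambda>x. x * (x + w) * ln (1 + w / x)) has_real_derivative
        (2 * x + w) * ln (1 + w / x) + x * (x + w) * (- w / (x * (x + w)))) (at x)"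
      by (rule DERIV_cong[OF DERIV_mult'[OF _ lnderiv[OF that]]])
        (auto intro!: derivative_eq_intros)
    moreover have "x * (x + w) * (- w / (x * (x + w))) = - w" using that w by simp
    moreover have "((\<lambda>x. (x + e) * w) has_real_derivative w) (at x)"
      by (auto intro!: derivative_eq_intros)
    ultimately show ?thesis unfolding h_def by (auto dest: DERIV_diff)
  qed
  have h2: "0 \<le> (2 * x + w) * ln (1 + w / x) - 2 * w" if "0 < x" for x
  proof -
    have "2 * (w / x) / (2 + w / x) \<le> ln (1 + w / x)"
      using w that by (intro ln_add_one_ge_rational) simp
    moreover have "2 * (w / x) / (2 + w / x) = 2 * w / (2 * x + w)"
      using w that by (simp add: field_simps)
    ultimately show ?thesis using w that by (simp add: field_simps)
  qed
  have h_mono: "h x \<le> h y" if "0 < x" "x \<le> y" for x y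
    using that(2)
  proof (rule DERIV_nonneg_imp_nondecreasing)
    fix u assume "x \<le> u" "u \<le> y"
    then have "0 < u" using that by simp
    then show "\<exists>d. (h has_real_derivative d) (at u) \<and> 0 \<le> d" using h1 h2 by blast
  qed
  have "h t = 0"
  proof -
    have tw: "t + w = (t + e) * (1 - t) / (1 - t - e)" using t by (simp add: w_def field_simps)
    have "t * (t + w) * ln (1 + w / t) = t * ((t + e) * (1 - t) / (1 - t - e)) * (e / (t * (1 - t)))"
      by (simp only: 2 D tw)
    also have "\<dots> = (t + e) * w" using t e by (simp add: w_def)
    finally show ?thesis by (simp add: h_def)
  qed
  have S_min: "S t \<le> S x" if "0 < x" for x
  proof (cases "t \<le> x")
    case True
    have "0 \<le> h y / (y * (y + w))" if "t \<le> y" for y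
      using h_mono[of t y] t w that \<open>h t = 0\<close> by simp
    then show ?thesis using True S' t(1)
      by (intro deriv_nonneg_imp_mono[of t x S "\<lambda>x. h x / (x * (x + w))"]) auto
  next
    case False
    have "h y / (y * (y + w)) \<le> 0" if "y \<le> t" "x \<le> y" for y
      using h_mono[of y t] w \<open>0 < x\<close> that \<open>h t = 0\<close> by (simp add: divide_nonpos_pos)
    then have "- S x \<le> - S t" using False S' that
      by (intro deriv_nonneg_imp_mono[of x t "\<lambda>x. - S x" "\<lambda>x. - (h x / (x * (x + w)))"])
        (auto intro!: DERIV_minus)
    then show ?thesis by simp
  qed
  have "ln (1 + w) + 2 * e\<^sup>2 \<le> S t"
  proof -
    have "2 * e\<^sup>2 \<le> (t + e) * ln ((t + e) / t) + (1 - (t + e)) * ln ((1 - (t + e)) / (1 - t))"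
      using bernoulli_pinsker[of t "t + e"] t e by simp
    moreover have "ln (1 + w) = - ln ((1 - (t + e)) / (1 - t))"
      using t e by (simp add: 1 ln_div diff_diff_eq)
    moreover have "ln (1 + w / t) = ln ((t + e) / t) - ln ((1 - (t + e)) / (1 - t))"
      using t e by (simp add: 2 ln_div ln_mult diff_diff_eq)
    ultimately show ?thesis by (simp only: S_def) (simp add: algebra_simps)
  qed
  then have "ln (1 + w) + 2 * e\<^sup>2 \<le> (x + e) * ln (1 + w / x)" if "0 < x" for x
    using S_min[OF that] by (simp only: S_def)
  with w show thesis by (rule that)
qed

section \<open>Uniform samples crossing a line\<close>

abbreviation unif :: "real measure" where "unif \<equiv> uniform_measure lborel {0..1}"

interpretation unif: prob_space unif
  by (intro prob_space_uniform_measure) auto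

interpretation unif_prod: product_prob_space "\<lambda>_ :: 'i. unif" I for I :: "'i set"
  by unfold_locales

text \<open>The slope \<open>N\<close> is kept apart from \<open>card I\<close> because the
  induction removes coordinates while the line stays the same. The line is tested at the coordinates
  only, which are the jump points of the counting function.\<close>

definition crossing :: "real \<Rightarrow> real \<Rightarrow> 'i set \<Rightarrow> real \<Rightarrow> ('i \<Rightarrow> real) set" where
  "crossing N c I x = {u \<in> I \<rightarrow>\<^sub>E UNIV. (\<forall>i\<in>I. 0 \<le> u i \<and> u i \<le> x) \<and>
     (\<exists>i\<in>I. c + N * u i < (\<Sum>j\<in>I. of_bool (u j \<le> u i)))}"

text \<open>The upper bound \<open>Y\<close> may vary with the point, so that the lemma serves both
  the crossing event itself, with \<open>Y\<close> constant, and its slices, where \<open>Y\<close>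
  is the largest coordinate.\<close>

lemma pred_count_crossing:
  fixes X :: "'i \<Rightarrow> 'a \<Rightarrow> real"
  assumes "finite J" and X: "\<And>j. j \<in> J \<Longrightarrow> X j \<in> borel_measurable M"
    and Y[measurable]: "Y \<in> borel_measurable M"
  shows "Measurable.pred M (\<lambda>u. (\<forall>i\<in>J. 0 \<le> X i u \<and> X i u \<le> Y u) \<and>
    (\<exists>i\<in>J. c + N * X i u < (\<Sum>j\<in>J. of_bool (X j u \<le> X i u))))"
proof -
  have p1: "Measurable.pred M (\<lambda>u. 0 \<le> X i u \<and> X i u \<le> Y u)" if "i \<in> J" for i
  proof -
    note [measurable] = X[OF that]
    show ?thesis by measurable
  qed
  have p2: "Measurable.pred M (\<lambda>u. c + N * X i u < (\<Sum>j\<in>J. of_bool (X j u \<le> X i u)))"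
    if "i \<in> J" for i
  proof -
    note [measurable] = X[OF that]
    have [measurable]: "(\<lambda>u. of_bool (X j u \<le> X i u) :: real) \<in> borel_measurable M" if "j \<in> J" for j
    proof -
      note [measurable] = X[OF that]
      show ?thesis unfolding of_bool_def by measurable
    qed
    show ?thesis by measurable
  qed
  note [measurable] = pred_intros_finite(3)[OF \<open>finite J\<close> p1] pred_intros_finite(4)[OF \<open>finite J\<close> p2]
  show ?thesis by measurable
qed

lemma sets_PiM_unif: "sets (\<Pi>\<^sub>M i\<in>I. unif) = sets (\<Pi>\<^sub>M i\<in>I. borel)"
  by (intro sets_PiM_cong) auto

lemma crossing_measurable:
  assumes "finite I"
  shows "crossing N c I x \<in> sets (\<Pi>\<^sub>M i\<in>I. unif)"
proof -
  have "{u \<in> space (\<Pi>\<^sub>M i\<in>I. borel). (\<forall>i\<in>I. 0 \<le> u i \<and> u i \<le> x) \<and>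
     (\<exists>i\<in>I. c + N * u i < (\<Sum>j\<in>I. of_bool (u j \<le> u i)))} \<in> sets (\<Pi>\<^sub>M i\<in>I. borel)"
    using assms by (intro predE pred_count_crossing) auto
  then show ?thesis by (simp add: sets_PiM_unif crossing_def space_PiM)
qed

text \<open>The index \<open>k\<close> is that of the largest coordinate, where the count is all of \<^term>\<open>card I\<close>; beyond
  \<open>a\<close> the line is above that level, so the crossing happens among the other coordinates.\<close>

lemma crossing_split:
  fixes a :: real
  assumes "finite I" "N > 0" "(real (card I) - c) / N \<le> a"
  shows "crossing N c I x \<subseteq> (I \<rightarrow>\<^sub>E {0..a}) \<union>
    (\<Union>k\<in>I. {u \<in> I \<rightarrow>\<^sub>E UNIV. u k \<in> {a..x} \<and> restrict u (I - {k}) \<in> crossing N c (I - {k}) (u k)})"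
proof
  fix u assume u: "u \<in> crossing N c I x"
  then obtain i where i: "i \<in> I" "c + N * u i < (\<Sum>j\<in>I. of_bool (u j \<le> u i))"
    and uI: "u \<in> I \<rightarrow>\<^sub>E UNIV" "\<And>i. i \<in> I \<Longrightarrow> 0 \<le> u i \<and> u i \<le> x"
    by (auto simp: crossing_def)
  have "Max (u ` I) \<in> u ` I" using assms(1) i(1) by (intro Max_in) auto
  then obtain k where k: "k \<in> I" "u k = Max (u ` I)" by auto
  then have k_max: "u j \<le> u k" if "j \<in> I" for j using assms(1) that by simp
  show "u \<in> (I \<rightarrow>\<^sub>E {0..a}) \<union>
    (\<Union>k\<in>I. {u \<in> I \<rightarrow>\<^sub>E UNIV. u k \<in> {a..x} \<and> restrict u (I - {k}) \<in> crossing N c (I - {k}) (u k)})"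
  proof (cases "u k \<le> a")
    case True
    then have "u \<in> I \<rightarrow>\<^sub>E {0..a}" using uI k_max order_trans[OF k_max True] by (auto simp: PiE_iff)
    then show ?thesis by simp
  next
    case False
    have "u i < u k"
    proof (rule ccontr)
      assume "\<not> u i < u k"
      then have ik: "u i = u k" using k_max[OF i(1)] by simp
      have "(\<Sum>j\<in>I. of_bool (u j \<le> u i) :: real) = (\<Sum>j\<in>I. 1)"
        using k_max ik by (intro sum.cong) auto
      then have "c + N * u k < card I" using i(2) ik by simp
      then have "u k < (real (card I) - c) / N" using assms(2) by (simp add: field_simps)
      then show False using False assms(3) by simp
    qed
    then have "(\<Sum>j\<in>I. of_bool (u j \<le> u i) :: real) = (\<Sum>j\<in>I - {k}. of_bool (u j \<le> u i))"
      using sum.remove[OF assms(1) k(1), of "\<lambda>j. of_bool (u j \<le> u i) :: real"] by simp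
    then have "c + N * u i < (\<Sum>j\<in>I - {k}. of_bool (u j \<le> u i))" "i \<in> I - {k}"
      using i \<open>u i < u k\<close> by auto
    then have "\<exists>i\<in>I - {k}. c + N * u i < (\<Sum>j\<in>I - {k}. of_bool (u j \<le> u i))" by (rule bexI)
    then have "restrict u (I - {k}) \<in> crossing N c (I - {k}) (u k)"
      using uI k_max by (simp add: crossing_def)
    then show ?thesis using uI k(1) False by auto
  qed
qed

lemma emeasure_unif_power:
  assumes "finite I" "0 \<le> a" "a \<le> 1"
  shows "emeasure (\<Pi>\<^sub>M i\<in>I. unif) (I \<rightarrow>\<^sub>E {0..a}) = ennreal (a ^ card I)"
proof -
  have "emeasure unif {0..a} = ennreal a"
    using assms by (simp add: emeasure_uniform_measure Int_absorb1 divide_ennreal_def)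
  then have "emeasure (\<Pi>\<^sub>M i\<in>I. unif) (I \<rightarrow>\<^sub>E {0..a}) = (\<Prod>i\<in>I. ennreal a)"
    using assms by (subst unif_prod.emeasure_PiM) auto
  then show ?thesis using assms by (simp add: ennreal_power)
qed

lemma nn_integral_power_shift:
  fixes K a x w :: real
  assumes "0 \<le> K" "0 \<le> w" "0 \<le> a" "a \<le> x" "x \<le> 1" "n > 0"
  shows "(\<integral>\<^sup>+y. ennreal (K * (y + w) ^ (n - 1)) * indicator {a..x} y \<partial>unif) =
    ennreal ((K * (x + w) ^ n - K * (a + w) ^ n) / real n)"
proof -
  have "(\<integral>\<^sup>+y. ennreal (K * (y + w) ^ (n - 1)) * indicator {a..x} y \<partial>unif) =
      (\<integral>\<^sup>+y. ennreal (K * (y + w) ^ (n - 1)) * indicator {a..x} y * indicator {0..1} y \<partial>lborel)"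
    by (subst nn_integral_uniform_measure) (auto simp: divide_ennreal_def)
  also have "\<dots> = (\<integral>\<^sup>+y. ennreal (K * (y + w) ^ (n - 1)) * indicator {a..x} y \<partial>lborel)"
    using assms by (intro nn_integral_cong) (auto simp: indicator_def)
  also have "\<dots> = ennreal (K * (x + w) ^ n / real n - K * (a + w) ^ n / real n)"
    using assms
    by (intro nn_integral_FTC_Icc) (auto intro!: derivative_eq_intros mult_nonneg_nonneg)
  finally show ?thesis by (simp add: diff_divide_distrib)
qed

text \<open>Induction on the number of points, along \<open>crossing_split\<close>. The cube
  contributes a^card I, which is at most K (a + w)^card I by the hypothesis at level
  \<open>card I\<close>. By the induction hypothesis, each choice of the largest coordinate
  contributes at most the integral of K (y + w)^(card I - 1) over [a, x]; the \<open>card I\<close>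
  choices together give K (x + w)^card I - K (a + w)^card I, and the sum telescopes.\<close>

lemma emeasure_crossing_le:
  fixes N c x w K :: real
  assumes "finite I" "N > 0" "0 \<le> w" "0 \<le> K"
    and K: "\<And>k. k \<le> card I \<Longrightarrow> c < real k \<Longrightarrow> ((real k - c) / N) ^ k \<le> K * ((real k - c) / N + w) ^ k"
    and "0 \<le> x" "x \<le> 1" "(real (card I) - c) / N \<le> x"
  shows "emeasure (\<Pi>\<^sub>M i\<in>I. unif) (crossing N c I x) \<le> ennreal (K * (x + w) ^ card I)"
  using assms
proof (induction "card I" arbitrary: I x)
  case 0
  then have "crossing N c I x = {}" by (simp add: crossing_def)
  then show ?case by simp
next
  case (Suc n)
  \<comment> \<open>If the line starts at or above level \<open>card I\<close>, the maximum with 0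
    makes \<open>a\<close> zero, and the cube has volume 0 because \<open>card I\<close> is
    positive.\<close>
  define a where "a = max 0 ((real (card I) - c) / N)"
  have a: "0 \<le> a" "a \<le> x" using Suc.prems by (auto simp: a_def)
  define B where "B k = {u \<in> I \<rightarrow>\<^sub>E UNIV. u k \<in> {a..x} \<and>
    restrict u (I - {k}) \<in> crossing N c (I - {k}) (u k)}" for k
  have a_pow: "a ^ card I \<le> K * (a + w) ^ card I"
  proof (cases "c < card I")
    case True
    then have "a = (real (card I) - c) / N" using Suc.prems by (simp add: a_def)
    then show ?thesis using Suc.prems(5)[of "card I"] True by simp
  next
    case False
    then have "a = 0" using Suc.prems by (simp add: a_def divide_nonpos_pos)
    then show ?thesis using Suc.prems(3,4) Suc.hyps(2)[symmetric] by simp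
  qed
  have sets_B: "B k \<in> sets (\<Pi>\<^sub>M i\<in>I. unif)" if "k \<in> I" for k
  proof -
    have "{u \<in> space (\<Pi>\<^sub>M i\<in>I. borel). u k \<in> {a..x} \<and> ((\<forall>i\<in>I - {k}. 0 \<le> u i \<and> u i \<le> u k) \<and>
       (\<exists>i\<in>I - {k}. c + N * u i < (\<Sum>j\<in>I - {k}. of_bool (u j \<le> u i))))} \<in> sets (\<Pi>\<^sub>M i\<in>I. borel)"
      using \<open>finite I\<close> that by (intro predE pred_intros_logic pred_count_crossing) auto
    moreover have "B k = {u \<in> space (\<Pi>\<^sub>M i\<in>I. borel). u k \<in> {a..x} \<and> ((\<forall>i\<in>I - {k}. 0 \<le> u i \<and> u i \<le> u k) \<and>
       (\<exists>i\<in>I - {k}. c + N * u i < (\<Sum>j\<in>I - {k}. of_bool (u j \<le> u i))))}"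
      by (auto simp: B_def crossing_def space_PiM)
    ultimately show ?thesis by (simp add: sets_PiM_unif)
  qed
  have B_le: "emeasure (\<Pi>\<^sub>M i\<in>I. unif) (B k) \<le> ennreal ((K * (x + w) ^ card I - K * (a + w) ^ card I) / card I)"
    if k: "k \<in> I" for k
  proof -
    have card_k: "card (I - {k}) = n" using Suc.hyps k Suc.prems(1) by simp
    have "emeasure (\<Pi>\<^sub>M i\<in>I. unif) (B k) = (\<integral>\<^sup>+u. indicator (B k) u \<partial>(\<Pi>\<^sub>M i\<in>I. unif))"
      using sets_B[OF k] by simp
    \<comment> \<open>Fubini with coordinate \<open>k\<close> outermost: for a fixed value
      \<open>y\<close> of that coordinate, the section of \<open>B k\<close> lies in the crossing
      event of the remaining coordinates in the box of side \<open>y\<close>.\<close>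
    also have "\<dots> = (\<integral>\<^sup>+y. \<integral>\<^sup>+u. indicator (B k) (u(k := y)) \<partial>(\<Pi>\<^sub>M i\<in>I - {k}. unif) \<partial>unif)"
      using unif_prod.product_nn_integral_insert_rev[of "I - {k}" k "indicator (B k)"]
        Suc.prems(1) sets_B[OF k] insert_Diff[OF k] by simp
    also have "\<dots> \<le> (\<integral>\<^sup>+y. ennreal (K * (y + w) ^ (card I - 1)) * indicator {a..x} y \<partial>unif)"
    proof (rule nn_integral_mono)
      fix y :: real
      have "(\<integral>\<^sup>+u. indicator (B k) (u(k := y)) \<partial>(\<Pi>\<^sub>M i\<in>I - {k}. unif)) \<le>
        (\<integral>\<^sup>+u. indicator (crossing N c (I - {k}) y) u * indicator {a..x} y \<partial>(\<Pi>\<^sub>M i\<in>I - {k}. unif))"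
      proof (rule nn_integral_mono)
        fix u assume "u \<in> space (\<Pi>\<^sub>M i\<in>I - {k}. unif)"
        then have "restrict (u(k := y)) (I - {k}) = u"
          by (auto simp: space_PiM PiE_iff extensional_def fun_eq_iff)
        then show "indicator (B k) (u(k := y)) \<le>
          (indicator (crossing N c (I - {k}) y) u * indicator {a..x} y :: ennreal)"
          by (auto simp: B_def indicator_def)
      qed
      also have "\<dots> = emeasure (\<Pi>\<^sub>M i\<in>I - {k}. unif) (crossing N c (I - {k}) y) * indicator {a..x} y"
        using crossing_measurable[of "I - {k}" N c y] Suc.prems(1) by (simp add: nn_integral_multc)
      also have "\<dots> \<le> ennreal (K * (y + w) ^ (card I - 1)) * indicator {a..x} y"
      proof (cases "y \<in> {a..x}")
        case True
        have "emeasure (\<Pi>\<^sub>M i\<in>I - {k}. unif) (crossing N c (I - {k}) y) \<le> ennreal (K * (y + w) ^ card (I - {k}))"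
        proof (rule Suc.hyps(1)[OF card_k[symmetric]])
          show "((real j - c) / N) ^ j \<le> K * ((real j - c) / N + w) ^ j" if "j \<le> card (I - {k})" "c < real j" for j
            using that Suc.prems(5)[of j] card_k Suc.hyps(2) by simp
          \<comment> \<open>The line reaches the lower level \<open>card (I - {k})\<close> earlier,
            hence before \<open>a\<close>; this makes the induction hypothesis available at every
            \<open>y\<close> from \<open>a\<close> on.\<close>
          have "(real (card (I - {k})) - c) / N \<le> (real (card I) - c) / N"
            using Suc.prems(2) card_k Suc.hyps(2)[symmetric] by (intro divide_right_mono) auto
          then show "(real (card (I - {k})) - c) / N \<le> y" using True by (auto simp: a_def)
        qed (use Suc.prems True a in auto)
        then show ?thesis using True card_k Suc.hyps(2)[symmetric] by simp
      qed simp
      finally show "(\<integral>\<^sup>+u. indicator (B k) (u(k := y)) \<partial>(\<Pi>\<^sub>M i\<in>I - {k}. unif)) \<le>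
        ennreal (K * (y + w) ^ (card I - 1)) * indicator {a..x} y" .
    qed
    also have "\<dots> = ennreal ((K * (x + w) ^ card I - K * (a + w) ^ card I) / card I)"
      using Suc.prems a Suc.hyps(2)[symmetric] by (intro nn_integral_power_shift) auto
    finally show ?thesis .
  qed
  have sets_cube: "(I \<rightarrow>\<^sub>E {0..a}) \<in> sets (\<Pi>\<^sub>M i\<in>I. unif)"
    using Suc.prems(1) by (intro sets_PiM_I_finite) auto
  have diff_nn: "K * (a + w) ^ card I \<le> K * (x + w) ^ card I"
    using a Suc.prems by (intro mult_left_mono power_mono) auto
  have split: "crossing N c I x \<subseteq> (I \<rightarrow>\<^sub>E {0..a}) \<union> (\<Union>k\<in>I. B k)"
    unfolding B_def using Suc.prems(1,2) by (rule crossing_split) (simp add: a_def)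
  have "emeasure (\<Pi>\<^sub>M i\<in>I. unif) (crossing N c I x) \<le>
      emeasure (\<Pi>\<^sub>M i\<in>I. unif) ((I \<rightarrow>\<^sub>E {0..a}) \<union> (\<Union>k\<in>I. B k))"
    using Suc.prems(1) by (intro emeasure_mono split sets.Un sets_cube sets.finite_UN sets_B)
  also have "\<dots> \<le> emeasure (\<Pi>\<^sub>M i\<in>I. unif) (I \<rightarrow>\<^sub>E {0..a}) + emeasure (\<Pi>\<^sub>M i\<in>I. unif) (\<Union>k\<in>I. B k)"
    using Suc.prems(1) by (intro emeasure_subadditive sets_cube sets.finite_UN sets_B)
  also have "\<dots> \<le> emeasure (\<Pi>\<^sub>M i\<in>I. unif) (I \<rightarrow>\<^sub>E {0..a}) + (\<Sum>k\<in>I. emeasure (\<Pi>\<^sub>M i\<in>I. unif) (B k))"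
    using sets_B Suc.prems(1) by (intro add_left_mono emeasure_subadditive_finite) auto
  also have "\<dots> \<le> ennreal (a ^ card I) +
      (\<Sum>k\<in>I. ennreal ((K * (x + w) ^ card I - K * (a + w) ^ card I) / card I))"
    using B_le a Suc.prems by (intro add_mono sum_mono) (auto simp: emeasure_unif_power)
  also have "\<dots> = ennreal (a ^ card I + (K * (x + w) ^ card I - K * (a + w) ^ card I))"
    using Suc.hyps(2)[symmetric] diff_nn a
    by (simp add: ennreal_of_nat_eq_real_of_nat ennreal_mult[symmetric] ennreal_plus[symmetric] del: ennreal_plus)
  also have "\<dots> \<le> ennreal (K * (x + w) ^ card I)"
    using a_pow by (intro ennreal_leI) simp
  finally show ?case .
qed

lemma dkw_uniform:
  fixes s :: real
  assumes I: "finite I" "I \<noteq> {}" and s: "0 < s" "s < 1"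
  shows "measure (\<Pi>\<^sub>M i\<in>I. unif) (crossing (card I) (card I * s) I 1) \<le> exp (- 2 * real (card I) * s\<^sup>2)"
proof -
  define n where "n = card I"
  have n: "n > 0" using I by (simp add: n_def card_gt_0_iff)
  obtain w where w: "0 < w"
    "\<And>x. 0 < x \<Longrightarrow> ln (1 + w) + 2 * s\<^sup>2 \<le> (x + s) * ln (1 + w / x)"
    using dkw_saddle[OF s] by blast
  \<comment> \<open>Chosen so that K (1 + w)^n = exp (-2 n s^2). The domination required at level
    \<open>k\<close> is then \<open>n\<close> times the saddle inequality at x = k/n - s,
    exponentiated.\<close>
  define K where "K = exp (- (n * (ln (1 + w) + 2 * s\<^sup>2)))"
  have "((real k - n * s) / n) ^ k \<le> K * ((real k - n * s) / n + w) ^ k" if k: "n * s < real k" for k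
  proof -
    define x where "x = (k - n * s) / n"
    have x: "0 < x" "x + s = k / n" using n k by (auto simp: x_def field_simps)
    have "n * (ln (1 + w) + 2 * s\<^sup>2) \<le> n * ((x + s) * ln (1 + w / x))"
      using w(2)[OF x(1)] by (intro mult_left_mono) auto
    also have "\<dots> = k * ln (1 + w / x)" using n x by simp
    also have "ln (1 + w / x) = ln (x + w) - ln x"
    proof -
      have "1 + w / x = (x + w) / x" using x by (simp add: add_divide_distrib)
      then show ?thesis using x w by (simp add: ln_div)
    qed
    finally have "k * ln x \<le> - (n * (ln (1 + w) + 2 * s\<^sup>2)) + k * ln (x + w)"
      by (simp add: algebra_simps)
    then have "exp (k * ln x) \<le> exp (- (n * (ln (1 + w) + 2 * s\<^sup>2)) + k * ln (x + w))" by simp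
    then show ?thesis
      unfolding K_def exp_add x_def[symmetric] using x w by (simp add: exp_of_nat_mult)
  qed
  then have "emeasure (\<Pi>\<^sub>M i\<in>I. unif) (crossing (card I) (card I * s) I 1) \<le> ennreal (K * (1 + w) ^ card I)"
    using I s w n by (intro emeasure_crossing_le) (auto simp: K_def n_def field_simps)
  also have "K * (1 + w) ^ card I = exp (- 2 * real (card I) * s\<^sup>2)"
  proof -
    have "(1 + w) ^ n = exp (n * ln (1 + w))" using w by (simp add: exp_of_nat_mult)
    then show ?thesis
      unfolding K_def n_def[symmetric] by (simp add: exp_add[symmetric] algebra_simps)
  qed
  finally show ?thesis
    by (simp add: unif_prod.emeasure_eq_measure)
qed

section \<open>The one-sided Dvoretzky-Kiefer-Wolfowitz-Massart inequality\<close>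

text \<open>The sublevel set is a closed half-line, and by continuity the value \<open>u\<close> is
  attained. Its supremum is the right end of the possibly flat stretch where the distribution
  function equals \<open>u\<close>, so the mass up to there is \<open>u\<close>.\<close>

lemma (in real_distribution) measure_cdf_le:
  assumes cont: "continuous_on UNIV (cdf M)" and u: "0 < u" "u < 1"
  shows "measure M {x. cdf M x \<le> u} = u"
proof -
  have "\<forall>\<^sub>F x in at_top. u < cdf M x"
    using cdf_lim_at_top_prob u(2) by (rule order_tendstoD)
  then obtain b where b: "u < cdf M b" by (auto simp: eventually_at_top_linorder)
  have "\<forall>\<^sub>F x in at_bot. cdf M x < u"
    using cdf_lim_at_bot u(1) by (rule order_tendstoD)
  then obtain a where a: "cdf M a < u" by (auto simp: eventually_at_bot_linorder)
  have "a \<le> b" using a b cdf_nondecreasing[of b a] by linarith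
  then obtain y where y: "cdf M y = u"
    using IVT'[of "cdf M" a u b] a b continuous_on_subset[OF cont] by auto
  define S where "S = {x. cdf M x \<le> u}"
  have "closed S" unfolding S_def using cont by (intro closed_Collect_le) auto
  moreover have "S \<noteq> {}" using y by (auto simp: S_def)
  moreover have bdd: "bdd_above S"
  proof (rule bdd_aboveI)
    fix x assume "x \<in> S"
    then show "x \<le> b" using b cdf_nondecreasing[of b x] by (cases "x \<le> b") (auto simp: S_def)
  qed
  ultimately have Sup_S: "Sup S \<in> S" by (intro closed_contains_Sup)
  have "S = {..Sup S}"
  proof (intro equalityI subsetI)
    fix x assume "x \<in> {..Sup S}"
    then show "x \<in> S" using Sup_S cdf_nondecreasing[of x "Sup S"] by (auto simp: S_def)
  qed (use bdd in \<open>auto intro: cSup_upper\<close>)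
  moreover have "cdf M (Sup S) = u"
    using Sup_S cdf_nondecreasing[of y "Sup S"] cSup_upper[of y S] bdd y by (auto simp: S_def)
  ultimately show ?thesis unfolding S_def cdf_def by simp
qed

lemma (in real_distribution) distr_cdf_eq_unif:
  assumes cont: "continuous_on UNIV (cdf M)"
  shows "distr M borel (cdf M) = distr unif borel (\<lambda>x. x)"
proof (rule cdf_unique)
  have meas[measurable]: "cdf M \<in> borel_measurable borel" using cont by (rule borel_measurable_continuous_onI)
  show "real_distribution (distr M borel (cdf M))" by (rule real_distribution_distr) measurable
  show "real_distribution (distr unif borel (\<lambda>x. x))" by (rule unif.real_distribution_distr) measurable
  have 1: "cdf (distr M borel (cdf M)) u = measure M {x. cdf M x \<le> u}" for u
    by (simp add: cdf_def2 measure_distr vimage_def)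
  have 2: "cdf (distr unif borel (\<lambda>x. x)) u = max 0 (min 1 u)" for u
  proof -
    have "{0..1} \<inter> {..u} = {0..min 1 u}" by auto
    then show ?thesis
      by (simp add: cdf_def2 measure_distr measure_uniform_measure)
  qed
  show "cdf (distr M borel (cdf M)) = cdf (distr unif borel (\<lambda>x. x))"
  proof
    fix u :: real
    consider "u < 0" | "u = 0" | "0 < u" "u < 1" | "1 \<le> u" by linarith
    then have "measure M {x. cdf M x \<le> u} = max 0 (min 1 u)"
    proof cases
      case 1
      then have "{x. cdf M x \<le> u} = {}" using cdf_nonneg by (auto simp: not_le intro: less_le_trans)
      then show ?thesis using 1 by simp
    next
      case 2
      \<comment> \<open>The set where the distribution function vanishes can be nonempty, and
        \<open>measure_cdf_le\<close> covers only levels strictly between 0 and 1; so its mass is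
        squeezed by arbitrarily small positive levels \<open>d\<close>.\<close>
      have "measure M {x. cdf M x \<le> 0} \<le> 0 + e" if "e > 0" for e
      proof -
        define d where "d = min e (1/2)"
        have "measure M {x. cdf M x \<le> 0} \<le> measure M {x. cdf M x \<le> d}"
          using that by (intro finite_measure_mono) (auto simp: d_def)
        also have "\<dots> = d" using that by (intro measure_cdf_le cont) (auto simp: d_def)
        finally show ?thesis by (simp add: d_def)
      qed
      then have "measure M {x. cdf M x \<le> 0} \<le> 0" by (rule field_le_epsilon)
      then show ?thesis using 2 by (simp add: measure_le_0_iff)
    next
      case 3
      then show ?thesis by (simp add: measure_cdf_le cont)
    next
      case 4
      then have "{x. cdf M x \<le> u} = space M" using cdf_bounded_prob by (auto intro: order_trans)
      then show ?thesis using 4 prob_space by simp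
    qed
    then show "cdf (distr M borel (cdf M)) u = cdf (distr unif borel (\<lambda>x. x)) u"
      by (simp add: 1 2)
  qed
qed

text \<open>The positive part of \<open>ecdf n xs - F\<close> attains its supremum at a sample point, which gives a
  manifestly measurable expression; the deficit \<open>F - ecdf n xs\<close> reduces to it by reflection.\<close>

definition ecdf_excess :: "nat \<Rightarrow> (real \<Rightarrow> real) \<Rightarrow> (nat \<Rightarrow> real) \<Rightarrow> real" where
  "ecdf_excess n F xs = max 0 (MAX i\<in>{1..n}. ecdf n xs (xs i) - F (xs i))"

lemma ecdf_nonneg: "0 \<le> ecdf n xs x"
  by (simp add: ecdf_def sum_nonneg)

lemma ecdf_le_1: "ecdf n xs x \<le> 1"
proof -
  have "(\<Sum>i=1..n. of_bool (xs i \<le> x) :: real) \<le> (\<Sum>i=1..n. 1)" by (intro sum_mono) simp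
  then show ?thesis by (cases "n = 0") (auto simp: ecdf_def divide_simps)
qed

text \<open>Moving \<open>x\<close> down to the largest sample point below it leaves the empirical
  value unchanged and can only lower \<open>F\<close>. To the left of all sample points the
  difference is at most 0, which the maximum with 0 in \<open>ecdf_excess\<close> absorbs.\<close>

lemma ecdf_diff_le_excess:
  assumes "mono F" "\<And>x. 0 \<le> F x"
  shows "ecdf n xs x - F x \<le> ecdf_excess n F xs"
proof (cases "\<exists>i\<in>{1..n}. xs i \<le> x")
  case True
  define I where "I = {i \<in> {1..n}. xs i \<le> x}"
  have "Max (xs ` I) \<in> xs ` I" using True by (intro Max_in) (auto simp: I_def)
  then obtain i where i: "i \<in> I" "xs i = Max (xs ` I)" by auto
  have "xs j \<le> xs i" if "j \<in> {1..n}" "xs j \<le> x" for j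
    using that unfolding i(2) by (intro Max_ge) (auto simp: I_def)
  then have "(\<Sum>j=1..n. of_bool (xs j \<le> x) :: real) \<le> (\<Sum>j=1..n. of_bool (xs j \<le> xs i))"
    by (intro sum_mono) auto
  then have "ecdf n xs x \<le> ecdf n xs (xs i)" unfolding ecdf_def by (intro mult_left_mono) auto
  moreover have "F (xs i) \<le> F x" using i(1) assms(1) by (auto simp: I_def mono_def)
  ultimately have "ecdf n xs x - F x \<le> ecdf n xs (xs i) - F (xs i)" by simp
  also have "\<dots> \<le> (MAX i\<in>{1..n}. ecdf n xs (xs i) - F (xs i))"
    using i(1) by (intro Max_ge) (auto simp: I_def)
  finally show ?thesis by (simp add: ecdf_excess_def)
next
  case False
  then have "ecdf n xs x = 0" by (simp add: ecdf_def)
  then show ?thesis using assms(2)[of x] by (simp add: ecdf_excess_def)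
qed

text \<open>1 - F_n(x) is the fraction of sample points beyond \<open>x\<close>. Reflection turns
  these into points to the left of \<open>- x\<close>, and sample points equal to \<open>x\<close>
  only enlarge the reflected count.\<close>

lemma ecdf_deficit_le_excess_uminus:
  assumes "mono F" "\<And>x. F x \<le> 1" "n \<ge> 1"
  shows "F x - ecdf n xs x \<le> ecdf_excess n (\<lambda>x. 1 - F (- x)) (\<lambda>i. - xs i)"
proof -
  have "1 - ecdf n xs x = 1 / real n * (\<Sum>i=1..n. 1 - of_bool (xs i \<le> x))"
    using assms(3) unfolding ecdf_def sum_subtractf right_diff_distrib by simp
  also have "\<dots> \<le> ecdf n (\<lambda>i. - xs i) (- x)"
    unfolding ecdf_def by (intro mult_left_mono sum_mono) auto
  finally have "1 - ecdf n xs x \<le> ecdf n (\<lambda>i. - xs i) (- x)" .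
  moreover have "ecdf n (\<lambda>i. - xs i) (- x) - (1 - F (- (- x))) \<le>
    ecdf_excess n (\<lambda>x. 1 - F (- x)) (\<lambda>i. - xs i)"
    using assms(1,2) by (intro ecdf_diff_le_excess) (auto simp: mono_def)
  ultimately show ?thesis by simp
qed

lemma ecdf_excess_measurable:
  assumes "F \<in> borel_measurable borel" "\<And>i. i \<in> {1..n} \<Longrightarrow> X i \<in> borel_measurable M"
  shows "(\<lambda>\<omega>. ecdf_excess n F (\<lambda>i. X i \<omega>)) \<in> borel_measurable M"
proof -
  have "(\<lambda>\<omega>. ecdf n (\<lambda>i. X i \<omega>) (X j \<omega>) - F (X j \<omega>)) \<in> borel_measurable M" if "j \<in> {1..n}" for j
  proof -
    note [measurable] = assms(1) assms(2)[OF that]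
    have [measurable]: "(\<lambda>\<omega>. of_bool (X i \<omega> \<le> X j \<omega>) :: real) \<in> borel_measurable M" if "i \<in> {1..n}" for i
    proof -
      note [measurable] = assms(2)[OF that]
      show ?thesis unfolding of_bool_def by measurable
    qed
    show ?thesis unfolding ecdf_def by measurable
  qed
  then show ?thesis
    unfolding ecdf_excess_def by (intro borel_measurable_max borel_measurable_Max) auto
qed

section \<open>The one-sided tail bound for samples with continuous distribution function, and
  reflection of samples\<close>

lemma iid_sampleD:
  assumes "iid_sample M n X F" "i \<in> {1..n}" "prob_space M"
  shows "X i \<in> borel_measurable M" "cdf (distr M borel (X i)) = F" "real_distribution (distr M borel (X i))"
proof -
  interpret prob_space M by fact
  show X: "X i \<in> borel_measurable M" using assms by (auto simp: iid_sample_def indep_vars_def)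
  show "cdf (distr M borel (X i)) = F" using assms by (auto simp: iid_sample_def)
  show "real_distribution (distr M borel (X i))" using X by simp
qed

lemma dkw_one_sided:
  assumes M: "prob_space M" and iid: "iid_sample M n X F" and cont: "continuous_on UNIV F"
    and n: "n \<ge> 1" and s: "0 \<le> s"
  shows "measure M {\<omega> \<in> space M. s < ecdf_excess n F (\<lambda>i. X i \<omega>)} \<le> exp (- 2 * real n * s\<^sup>2)"
proof -
  interpret prob_space M by fact
  note X = iid_sampleD[OF iid _ M]
  interpret F: real_distribution "distr M borel (X 1)" using X[of 1] n by simp
  have F1: "cdf (distr M borel (X 1)) = F" using X[of 1] n by simp
  have F_bounds: "0 \<le> F x" "F x \<le> 1" for x
    using F.cdf_nonneg[of x] F.cdf_bounded_prob[of x] unfolding F1 by auto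
  have F_mono: "F x \<le> F y" if "x \<le> y" for x y
    using F.cdf_nondecreasing[OF that] unfolding F1 .
  have F_meas[measurable]: "F \<in> borel_measurable borel" using cont by (rule borel_measurable_continuous_onI)
  \<comment> \<open>At \<open>s = 0\<close> the bound is 1, and for \<open>s\<close> at least 1 the
    event is empty because the excess never exceeds 1. The range between is that of
    \<open>dkw_uniform\<close>, applied to the independent uniform variables F(X_i).\<close>
  consider "s = 0" | "1 \<le> s" | "0 < s" "s < 1" using s by linarith
  then show ?thesis
  proof cases
    case 1
    then show ?thesis by simp
  next
    case 2
    have "ecdf_excess n F (\<lambda>i. X i \<omega>) \<le> 1" for \<omega>
    proof -
      have "ecdf n (\<lambda>i. X i \<omega>) (X i \<omega>) - F (X i \<omega>) \<le> 1" for i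
        using ecdf_le_1[of n "\<lambda>i. X i \<omega>" "X i \<omega>"] F_bounds(1)[of "X i \<omega>"] by linarith
      then show ?thesis using n by (simp add: ecdf_excess_def)
    qed
    then have "{\<omega> \<in> space M. s < ecdf_excess n F (\<lambda>i. X i \<omega>)} = {}" using 2 by (auto simp: not_less intro: order_trans)
    then show ?thesis by (simp only: measure_empty) simp
  next
    case 3
    define U where "U i \<omega> = F (X i \<omega>)" for i \<omega>
    have U: "U i \<in> borel_measurable M" if "i \<in> {1..n}" for i
      using X(1)[OF that] unfolding U_def by measurable
    have "indep_vars (\<lambda>_. borel) X {1..n}"
      using iid by (simp add: iid_sample_def)
    then have "indep_vars (\<lambda>_. borel) U {1..n}"
      unfolding U_def by (rule indep_vars_compose2[where Y = "\<lambda>_. F"]) (rule F_meas)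
    then have "distr M (\<Pi>\<^sub>M i\<in>{1..n}. borel) (\<lambda>\<omega>. \<lambda>i\<in>{1..n}. U i \<omega>) = (\<Pi>\<^sub>M i\<in>{1..n}. distr M borel (U i))"
      using n U by (subst (asm) indep_vars_iff_distr_eq_PiM') auto
    also have "\<dots> = (\<Pi>\<^sub>M i\<in>{1..n}. unif)"
    proof (rule PiM_cong)
      fix i assume i: "i \<in> {1..n}"
      interpret Fi: real_distribution "distr M borel (X i)" using X[OF i] by simp
      have "distr M borel (U i) = distr (distr M borel (X i)) borel F"
        using X(1)[OF i] by (subst distr_distr) (auto simp: U_def[abs_def] comp_def)
      also have "\<dots> = distr unif borel (\<lambda>x. x)"
        using Fi.distr_cdf_eq_unif X(2)[OF i] cont by simp
      also have "\<dots> = unif" by (rule distr_id2) simp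
      finally show "distr M borel (U i) = unif" .
    qed simp
    finally have joint: "distr M (\<Pi>\<^sub>M i\<in>{1..n}. borel) (\<lambda>\<omega>. \<lambda>i\<in>{1..n}. U i \<omega>) = (\<Pi>\<^sub>M i\<in>{1..n}. unif)" .
    define E where "E = crossing (real n) (n * s) {1..n} 1"
    have E: "E \<in> sets (\<Pi>\<^sub>M i\<in>{1..n}. borel)"
      using crossing_measurable[of "{1..n}" "real n" "n * s" 1] by (simp add: E_def sets_PiM_unif)
    have vec: "(\<lambda>\<omega>. \<lambda>i\<in>{1..n}. U i \<omega>) \<in> measurable M (\<Pi>\<^sub>M i\<in>{1..n}. borel)"
      using U by (intro measurable_restrict) auto
    have "{\<omega> \<in> space M. s < ecdf_excess n F (\<lambda>i. X i \<omega>)} \<subseteq> (\<lambda>\<omega>. \<lambda>i\<in>{1..n}. U i \<omega>) -` E \<inter> space M"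
    proof
      fix \<omega> assume \<omega>: "\<omega> \<in> {\<omega> \<in> space M. s < ecdf_excess n F (\<lambda>i. X i \<omega>)}"
      then have "s < (MAX i\<in>{1..n}. ecdf n (\<lambda>i. X i \<omega>) (X i \<omega>) - F (X i \<omega>))"
        using 3 by (simp add: ecdf_excess_def less_max_iff_disj)
      then obtain i where i: "i \<in> {1..n}" "s < ecdf n (\<lambda>i. X i \<omega>) (X i \<omega>) - F (X i \<omega>)"
        using n by (subst (asm) Max_gr_iff) auto
      \<comment> \<open>Only an inequality holds pointwise, since \<open>F\<close> may be flat and
        create ties; it goes in the direction that keeps the line crossed.\<close>
      have "(\<Sum>j=1..n. of_bool (X j \<omega> \<le> X i \<omega>) :: real) \<le> (\<Sum>j=1..n. of_bool (U j \<omega> \<le> U i \<omega>))"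
        using F_mono by (intro sum_mono) (auto simp: U_def)
      moreover have "n * s + n * U i \<omega> < (\<Sum>j=1..n. of_bool (X j \<omega> \<le> X i \<omega>))"
      proof -
        have "n * (s + U i \<omega>) < n * ecdf n (\<lambda>i. X i \<omega>) (X i \<omega>)"
          using i(2) n by (intro mult_strict_left_mono) (auto simp: U_def)
        then show ?thesis using n by (simp add: ecdf_def algebra_simps)
      qed
      moreover have "(\<Sum>j=1..n. of_bool ((\<lambda>i\<in>{1..n}. U i \<omega>) j \<le> (\<lambda>i\<in>{1..n}. U i \<omega>) i) :: real) =
          (\<Sum>j=1..n. of_bool (U j \<omega> \<le> U i \<omega>))"
        using i(1) by (intro sum.cong) auto
      ultimately have "n * s + n * (\<lambda>i\<in>{1..n}. U i \<omega>) i <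
          (\<Sum>j=1..n. of_bool ((\<lambda>i\<in>{1..n}. U i \<omega>) j \<le> (\<lambda>i\<in>{1..n}. U i \<omega>) i))"
        using i(1) by simp
      with i(1) have "\<exists>i\<in>{1..n}. n * s + n * (\<lambda>i\<in>{1..n}. U i \<omega>) i <
          (\<Sum>j=1..n. of_bool ((\<lambda>i\<in>{1..n}. U i \<omega>) j \<le> (\<lambda>i\<in>{1..n}. U i \<omega>) i))"
        by (rule bexI[rotated])
      moreover have "\<forall>i\<in>{1..n}. 0 \<le> (\<lambda>i\<in>{1..n}. U i \<omega>) i \<and> (\<lambda>i\<in>{1..n}. U i \<omega>) i \<le> 1"
        using F_bounds by (simp add: U_def)
      ultimately have "(\<lambda>i\<in>{1..n}. U i \<omega>) \<in> E"
        unfolding E_def crossing_def by (intro CollectI conjI) auto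
      then show "\<omega> \<in> (\<lambda>\<omega>. \<lambda>i\<in>{1..n}. U i \<omega>) -` E \<inter> space M"
        using \<omega> by simp
    qed
    then have "measure M {\<omega> \<in> space M. s < ecdf_excess n F (\<lambda>i. X i \<omega>)} \<le>
        measure M ((\<lambda>\<omega>. \<lambda>i\<in>{1..n}. U i \<omega>) -` E \<inter> space M)"
      using measurable_sets[OF vec E] by (rule finite_measure_mono)
    also have "\<dots> = measure (distr M (\<Pi>\<^sub>M i\<in>{1..n}. borel) (\<lambda>\<omega>. \<lambda>i\<in>{1..n}. U i \<omega>)) E"
      using vec E by (simp add: measure_distr)
    also have "\<dots> \<le> exp (- 2 * real n * s\<^sup>2)"
      using dkw_uniform[of "{1..n}" s] 3 n unfolding joint E_def by simp
    finally show ?thesis .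
  qed
qed

text \<open>The reflected variable is at most \<open>x\<close> when the original is at least
  \<open>- x\<close>; the possible atom at \<open>- x\<close> has mass 0 because \<open>F\<close> is
  continuous.\<close>

lemma iid_sample_uminus:
  assumes M: "prob_space M" and iid: "iid_sample M n X F" and cont: "continuous_on UNIV F"
  shows "iid_sample M n (\<lambda>i \<omega>. - X i \<omega>) (\<lambda>x. 1 - F (- x))"
proof -
  interpret prob_space M by fact
  have "cdf (distr M borel (\<lambda>\<omega>. - X i \<omega>)) = (\<lambda>x. 1 - F (- x))" if i: "i \<in> {1..n}" for i
  proof
    fix x
    note X = iid_sampleD[OF iid i M]
    note [measurable] = X(1)
    interpret D: real_distribution "distr M borel (X i)" by (rule X(3))
    have "(\<lambda>\<omega>. - X i \<omega>) -` {..x} \<inter> space M = X i -` {- x..} \<inter> space M" by auto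
    then have "cdf (distr M borel (\<lambda>\<omega>. - X i \<omega>)) x = measure (distr M borel (X i)) {- x..}"
      by (simp add: cdf_def2 measure_distr)
    also have "{- x..} = (UNIV - {..- x}) \<union> {- x}" by auto
    also have "measure (distr M borel (X i)) \<dots> =
        measure (distr M borel (X i)) (UNIV - {..- x}) + measure (distr M borel (X i)) {- x}"
      by (intro D.finite_measure_Union) auto
    also have "measure (distr M borel (X i)) {- x} = 0"
      using cont X(2) by (subst D.isCont_cdf[symmetric]) (simp add: continuous_on_eq_continuous_at)
    also have "measure (distr M borel (X i)) (UNIV - {..- x}) = 1 - F (- x)"
    proof -
      have "measure (distr M borel (X i)) {..- x} = F (- x)"
        using fun_cong[OF X(2), of "- x"] unfolding cdf_def2 .
      then show ?thesis using D.prob_compl[of "{..- x}"] by simp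
    qed
    finally show "cdf (distr M borel (\<lambda>\<omega>. - X i \<omega>)) x = 1 - F (- x)" by simp
  qed
  moreover have "indep_vars (\<lambda>_. borel) X {1..n}"
    using iid by (simp add: iid_sample_def)
  then have "indep_vars (\<lambda>_. borel) (\<lambda>i \<omega>. - X i \<omega>) {1..n}"
    by (rule indep_vars_compose2[where Y = "\<lambda>_. uminus"]) simp
  ultimately show ?thesis by (simp add: iid_sample_def)
qed

section \<open>Sums of independent variables with Gaussian tails\<close>

lemma erf_has_real_derivative:
  "(erf has_real_derivative 2 / sqrt pi * exp (- x\<^sup>2)) (at x)"
proof -
  have "((\<lambda>u. LBINT s=ereal 0..ereal u. exp (- s\<^sup>2)) has_vector_derivative exp (- x\<^sup>2))
      (at x within {- \<bar>x\<bar> - 1..\<bar>x\<bar> + 1})"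
  proof (rule interval_integral_FTC2)
    show "continuous_on {- \<bar>x\<bar> - 1..\<bar>x\<bar> + 1} (\<lambda>s. exp (- s\<^sup>2))"
      by (intro continuous_intros)
  qed auto
  moreover have "at x within {- \<bar>x\<bar> - 1..\<bar>x\<bar> + 1} = at x"
    by (rule at_within_interior) (auto simp: interior_atLeastAtMost_real)
  ultimately have "((\<lambda>u. LBINT s=ereal 0..ereal u. exp (- s\<^sup>2)) has_real_derivative exp (- x\<^sup>2)) (at x)"
    by (simp add: has_real_derivative_iff_has_vector_derivative)
  then have "((\<lambda>u. 2 / sqrt pi * (LBINT s=ereal 0..ereal u. exp (- s\<^sup>2))) has_real_derivative
      2 / sqrt pi * exp (- x\<^sup>2)) (at x)"
    by (rule DERIV_cmult)
  then show ?thesis by (simp add: erf_def[abs_def] zero_ereal_def)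
qed

lemma erf_minus: "erf (- x) = - erf x"
proof -
  have "((\<lambda>x. erf x + erf (- x)) has_real_derivative 0) (at x)" for x
  proof -
    have "((\<lambda>x. erf (- x)) has_real_derivative - (2 / sqrt pi * exp (- x\<^sup>2))) (at x)"
      using DERIV_chain2[OF erf_has_real_derivative DERIV_minus[OF DERIV_ident], of x] by simp
    from DERIV_add[OF erf_has_real_derivative this] show ?thesis by simp
  qed
  then have "erf x + erf (- x) = erf 0 + erf (- 0)"
    by (intro DERIV_isconst_all[of "\<lambda>x. erf x + erf (- x)"]) auto
  moreover have "erf 0 = 0" by (simp add: erf_def zero_ereal_def)
  ultimately show ?thesis by simp
qed

text \<open>Completing the square with v = u - \<beta> z / \<sigma> turns the exponent into \<alpha>
  \<beta> z^2 / \<sigma> + \<sigma> v^2, and \<sigma> (z - u) = \<alpha> z - \<sigma> v. The part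
  linear in v integrates to a Gaussian, the constant part to an error function.\<close>

lemma gaussian_convolution_antiderivative:
  fixes \<alpha> \<beta> z :: real
  assumes "0 < \<alpha>" "0 < \<beta>"
  defines "\<sigma> \<equiv> \<alpha> + \<beta>"
  shows "((\<lambda>u. \<beta> / \<sigma> * exp (- (\<alpha> * u\<^sup>2 + \<beta> * (z - u)\<^sup>2)) +
      sqrt pi * \<alpha> * \<beta> * z / (\<sigma> * sqrt \<sigma>) * exp (- (\<alpha> * \<beta> * z\<^sup>2 / \<sigma>)) *
        erf (sqrt \<sigma> * (u - \<beta> * z / \<sigma>))) has_real_derivative
    exp (- (\<alpha> * u\<^sup>2)) * (2 * \<beta> * (z - u) * exp (- (\<beta> * (z - u)\<^sup>2)))) (at u)"
proof -
  have s: "0 < \<sigma>" using assms by simp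
  define v where "v = u - \<beta> * z / \<sigma>"
  define E where "E = exp (- (\<alpha> * u\<^sup>2 + \<beta> * (z - u)\<^sup>2))"
  have sv: "\<sigma> * v = \<alpha> * u - \<beta> * (z - u)"
  proof -
    have "\<sigma> * v = \<sigma> * u - \<beta> * z" using s by (simp add: v_def right_diff_distrib)
    then show ?thesis by (simp add: \<sigma>_def algebra_simps)
  qed
  have quad: "\<alpha> * u\<^sup>2 + \<beta> * (z - u)\<^sup>2 = \<alpha> * \<beta> * z\<^sup>2 / \<sigma> + \<sigma> * v\<^sup>2"
  proof -
    have "\<sigma> * (\<alpha> * u\<^sup>2 + \<beta> * (z - u)\<^sup>2) = \<alpha> * \<beta> * z\<^sup>2 + (\<sigma> * v)\<^sup>2"
      unfolding sv by (simp add: \<sigma>_def power2_eq_square algebra_simps)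
    then have "\<alpha> * u\<^sup>2 + \<beta> * (z - u)\<^sup>2 = (\<alpha> * \<beta> * z\<^sup>2 + (\<sigma> * v)\<^sup>2) / \<sigma>"
      using s by (simp add: eq_divide_eq mult.commute)
    then show ?thesis using s by (simp add: add_divide_distrib power2_eq_square)
  qed
  have d1: "((\<lambda>u. \<beta> / \<sigma> * exp (- (\<alpha> * u\<^sup>2 + \<beta> * (z - u)\<^sup>2))) has_real_derivative
      \<beta> / \<sigma> * (E * (- 2 * (\<sigma> * v)))) (at u)"
  proof -
    have "((\<lambda>u. \<alpha> * u\<^sup>2 + \<beta> * (z - u)\<^sup>2) has_real_derivative 2 * (\<sigma> * v)) (at u)"
      unfolding sv by (auto intro!: derivative_eq_intros simp: algebra_simps)
    from DERIV_cmult[OF DERIV_chain2[OF DERIV_exp DERIV_minus[OF this]], of "\<beta> / \<sigma>"]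
    show ?thesis by (simp add: E_def)
  qed
  have "((\<lambda>u. sqrt \<sigma> * (u - \<beta> * z / \<sigma>)) has_real_derivative sqrt \<sigma>) (at u)"
    by (auto intro!: derivative_eq_intros)
  from DERIV_chain2[OF erf_has_real_derivative this]
  have "((\<lambda>u. erf (sqrt \<sigma> * (u - \<beta> * z / \<sigma>))) has_real_derivative
      2 / sqrt pi * exp (- (\<sigma> * v\<^sup>2)) * sqrt \<sigma>) (at u)"
    using s by (simp add: v_def power_mult_distrib)
  from DERIV_cmult[OF this, of "sqrt pi * \<alpha> * \<beta> * z / (\<sigma> * sqrt \<sigma>) * exp (- (\<alpha> * \<beta> * z\<^sup>2 / \<sigma>))"]
  have d2: "((\<lambda>u. sqrt pi * \<alpha> * \<beta> * z / (\<sigma> * sqrt \<sigma>) * exp (- (\<alpha> * \<beta> * z\<^sup>2 / \<sigma>)) *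
        erf (sqrt \<sigma> * (u - \<beta> * z / \<sigma>))) has_real_derivative 2 * \<alpha> * \<beta> * z / \<sigma> * E) (at u)"
  proof (rule DERIV_cong)
    have "E = exp (- (\<alpha> * \<beta> * z\<^sup>2 / \<sigma>)) * exp (- (\<sigma> * v\<^sup>2))"
      by (simp add: E_def quad exp_add[symmetric])
    then show "sqrt pi * \<alpha> * \<beta> * z / (\<sigma> * sqrt \<sigma>) * exp (- (\<alpha> * \<beta> * z\<^sup>2 / \<sigma>)) *
        (2 / sqrt pi * exp (- (\<sigma> * v\<^sup>2)) * sqrt \<sigma>) = 2 * \<alpha> * \<beta> * z / \<sigma> * E"
      using s by simp
  qed
  have "\<beta> / \<sigma> * (E * (- 2 * (\<sigma> * v))) + 2 * \<alpha> * \<beta> * z / \<sigma> * E =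
      (2 * \<beta> / \<sigma>) * (\<alpha> * z - \<sigma> * v) * E"
    by (simp add: algebra_simps add_divide_distrib diff_divide_distrib)
  also have "\<alpha> * z - \<sigma> * v = \<sigma> * (z - u)" unfolding sv by (simp add: \<sigma>_def algebra_simps)
  also have "(2 * \<beta> / \<sigma>) * (\<sigma> * (z - u)) * E = 2 * \<beta> * (z - u) * E" using s by simp
  also have "\<dots> = exp (- (\<alpha> * u\<^sup>2)) * (2 * \<beta> * (z - u) * exp (- (\<beta> * (z - u)\<^sup>2)))"
    by (simp add: E_def exp_add[symmetric])
  finally show ?thesis using DERIV_add[OF d1 d2] by simp
qed

lemma nn_integral_gaussian_step:
  fixes \<beta> z :: real
  assumes "0 < \<beta>" "a \<le> c" "c \<le> z"
  shows "(\<integral>\<^sup>+u. ennreal (2 * \<beta> * (z - u) * exp (- (\<beta> * (z - u)\<^sup>2))) * indicator {a..c} u \<partial>lborel) =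
    ennreal (exp (- (\<beta> * (z - c)\<^sup>2)) - exp (- (\<beta> * (z - a)\<^sup>2)))"
  using assms
  by (intro nn_integral_FTC_Icc)
    (auto intro!: derivative_eq_intros mult_nonneg_nonneg simp: algebra_simps)

text \<open>The Gaussian bound at \<open>z - s\<close> is its value at s = a plus the integral of
  its derivative from a to s; past s = z - b it is replaced by 1, which costs a jump of 1 - exp
  (-\<beta> b^2). Expressing the dependence on \<open>s\<close> through indicators of half-lines
  means that integration against the law of a variable produces only tail probabilities of that
  variable.\<close>

lemma gaussian_tail_decomposition:
  fixes \<beta> z s :: real
  assumes "0 < \<beta>" "0 \<le> b" "a + b \<le> z"
    and tail: "\<And>t. b \<le> t \<Longrightarrow> p t \<le> exp (- (\<beta> * t\<^sup>2))" and p1: "\<And>t. p t \<le> 1"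
    and anti: "\<And>t t'. t \<le> t' \<Longrightarrow> p t' \<le> p t"
  shows "ennreal (p (z - s)) \<le> ennreal (exp (- (\<beta> * (z - a)\<^sup>2)))
      + ennreal (1 - exp (- (\<beta> * b\<^sup>2))) * indicator {z - b<..} s
      + (\<integral>\<^sup>+u. ennreal (2 * \<beta> * (z - u) * exp (- (\<beta> * (z - u)\<^sup>2))) * indicator {a..z - b} u
            * indicator {u<..} s \<partial>lborel)"
    (is "_ \<le> _ + _ + ?I")
proof -
  have e1: "exp (- (\<beta> * b\<^sup>2)) \<le> 1" using assms by simp
  consider "s \<le> a" | "a < s" "s \<le> z - b" | "z - b < s" by linarith
  then show ?thesis
  proof cases
    case 1
    have "p (z - s) \<le> exp (- (\<beta> * (z - a)\<^sup>2))"
      using 1 assms(3) by (intro order_trans[OF anti tail]) auto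
    then have "ennreal (p (z - s)) \<le> ennreal (exp (- (\<beta> * (z - a)\<^sup>2)))" by (rule ennreal_leI)
    then show ?thesis by (simp add: add_increasing2)
  next
    case 2
    \<comment> \<open>\<open>{u<..}\<close> excludes the endpoint u = s of the integration interval,
      so the two integrands agree only almost everywhere.\<close>
    have "AE u in lborel. u \<noteq> s" by (rule AE_lborel_singleton)
    then have "?I = (\<integral>\<^sup>+u. ennreal (2 * \<beta> * (z - u) * exp (- (\<beta> * (z - u)\<^sup>2))) * indicator {a..s} u \<partial>lborel)"
      using 2 by (intro nn_integral_cong_AE) (auto split: split_indicator elim!: eventually_mono)
    also have "\<dots> = ennreal (exp (- (\<beta> * (z - s)\<^sup>2)) - exp (- (\<beta> * (z - a)\<^sup>2)))"
      using 2 assms by (intro nn_integral_gaussian_step) auto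
    finally have I: "?I = ennreal (exp (- (\<beta> * (z - s)\<^sup>2)) - exp (- (\<beta> * (z - a)\<^sup>2)))" .
    have "exp (- (\<beta> * (z - a)\<^sup>2)) \<le> exp (- (\<beta> * (z - s)\<^sup>2))"
      using 2 assms by (simp add: power_mono)
    then have "ennreal (exp (- (\<beta> * (z - a)\<^sup>2))) + ?I = ennreal (exp (- (\<beta> * (z - s)\<^sup>2)))"
      unfolding I by (simp add: ennreal_plus[symmetric] del: ennreal_plus)
    moreover have "p (z - s) \<le> exp (- (\<beta> * (z - s)\<^sup>2))" using 2 by (intro tail) simp
    ultimately show ?thesis using 2 by (simp add: ennreal_leI)
  next
    case 3
    then have "?I = (\<integral>\<^sup>+u. ennreal (2 * \<beta> * (z - u) * exp (- (\<beta> * (z - u)\<^sup>2))) * indicator {a..z - b} u \<partial>lborel)"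
      by (intro nn_integral_cong) (auto split: split_indicator)
    also have "\<dots> = ennreal (exp (- (\<beta> * (z - (z - b))\<^sup>2)) - exp (- (\<beta> * (z - a)\<^sup>2)))"
      using assms by (intro nn_integral_gaussian_step) auto
    finally have I: "?I = ennreal (exp (- (\<beta> * b\<^sup>2)) - exp (- (\<beta> * (z - a)\<^sup>2)))" by simp
    have "exp (- (\<beta> * (z - a)\<^sup>2)) \<le> exp (- (\<beta> * b\<^sup>2))"
      using assms by (simp add: power_mono)
    then have "ennreal (exp (- (\<beta> * (z - a)\<^sup>2))) + ennreal (1 - exp (- (\<beta> * b\<^sup>2))) + ?I = ennreal 1"
      using e1 unfolding I by (simp add: ennreal_plus[symmetric] del: ennreal_plus ennreal_1)
    moreover have "ennreal (p (z - s)) \<le> ennreal 1" using p1 by (rule ennreal_leI)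
    ultimately show ?thesis using 3 by simp
  qed
qed

text \<open>Conditioning on \<open>A\<close> leaves the tail of \<open>B\<close> at
  \<open>z - s\<close>, to which the decomposition applies. Integrating it over the law of
  \<open>A\<close> requires the tail of \<open>A\<close> at z - b and at u in [a, z - b], all at
  least \<open>a\<close>.\<close>

lemma (in prob_space) gaussian_tail_sum:
  fixes \<alpha> \<beta> a b z :: real
  assumes indep: "indep_var borel A borel B"
    and pos: "0 < \<beta>" "0 \<le> b" "a + b \<le> z"
    and tail_A: "\<And>t. a \<le> t \<Longrightarrow> prob {\<omega> \<in> space M. t < A \<omega>} \<le> exp (- (\<alpha> * t\<^sup>2))"
    and tail_B: "\<And>t. b \<le> t \<Longrightarrow> prob {\<omega> \<in> space M. t < B \<omega>} \<le> exp (- (\<beta> * t\<^sup>2))"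
    and \<Phi>: "\<And>u. (\<Phi> has_real_derivative exp (- (\<alpha> * u\<^sup>2)) * (2 * \<beta> * (z - u) * exp (- (\<beta> * (z - u)\<^sup>2)))) (at u)"
  shows "prob {\<omega> \<in> space M. z < A \<omega> + B \<omega>} \<le> exp (- (\<beta> * (z - a)\<^sup>2))
    + (1 - exp (- (\<beta> * b\<^sup>2))) * exp (- (\<alpha> * (z - b)\<^sup>2)) + (\<Phi> (z - b) - \<Phi> a)"
proof -
  have [measurable]: "A \<in> borel_measurable M" "B \<in> borel_measurable M"
    using indep by (auto dest: indep_var_rv1 indep_var_rv2)
  define P Q where "P = distr M borel A" and "Q = distr M borel B"
  interpret P: prob_space P unfolding P_def by (rule prob_space_distr) measurable
  interpret Q: prob_space Q unfolding Q_def by (rule prob_space_distr) measurable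
  have sets_PQ[measurable_cong]: "sets P = sets borel" "sets Q = sets borel" by (simp_all add: P_def Q_def)
  interpret PL: pair_sigma_finite P lborel by standard
  define \<psi> where "\<psi> u = 2 * \<beta> * (z - u) * exp (- (\<beta> * (z - u)\<^sup>2))" for u
  have \<psi>_meas[measurable]: "\<psi> \<in> borel_measurable borel" unfolding \<psi>_def by measurable
  have P_tail: "emeasure P {t<..} = prob {\<omega> \<in> space M. t < A \<omega>}" for t
    by (simp add: P_def emeasure_distr emeasure_eq_measure vimage_def Int_def conj_commute)
  have Q_tail: "emeasure Q {t<..} = prob {\<omega> \<in> space M. t < B \<omega>}" for t
    by (simp add: Q_def emeasure_distr emeasure_eq_measure vimage_def Int_def conj_commute)
  define S where "S = {x :: real \<times> real. z < fst x + snd x}"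
  have "{x \<in> space (borel \<Otimes>\<^sub>M borel). z < fst x + snd x} \<in> sets (borel \<Otimes>\<^sub>M borel)" by measurable
  then have S: "S \<in> sets (borel \<Otimes>\<^sub>M borel)" by (simp add: S_def space_pair_measure)
  have "ennreal (prob {\<omega> \<in> space M. z < A \<omega> + B \<omega>}) =
      emeasure (distr M (borel \<Otimes>\<^sub>M borel) (\<lambda>x. (A x, B x))) S"
    using S by (simp add: emeasure_distr emeasure_eq_measure S_def vimage_def Int_def conj_commute)
  also have "\<dots> = emeasure (P \<Otimes>\<^sub>M Q) S"
    using indep by (simp add: indep_var_distribution_eq P_def Q_def)
  also have "\<dots> = (\<integral>\<^sup>+s. emeasure Q (Pair s -` S) \<partial>P)"
    using S by (intro Q.emeasure_pair_measure_alt) (simp cong: sets_pair_measure_cong add: sets_PQ)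
  also have "\<dots> = (\<integral>\<^sup>+s. ennreal (prob {\<omega> \<in> space M. z - s < B \<omega>}) \<partial>P)"
  proof (rule nn_integral_cong)
    fix s
    have "Pair s -` S = {z - s<..}" by (auto simp: S_def)
    then show "emeasure Q (Pair s -` S) = ennreal (prob {\<omega> \<in> space M. z - s < B \<omega>})"
      by (simp only: Q_tail)
  qed
  also have "\<dots> \<le> (\<integral>\<^sup>+s. ennreal (exp (- (\<beta> * (z - a)\<^sup>2)))
      + ennreal (1 - exp (- (\<beta> * b\<^sup>2))) * indicator {z - b<..} s
      + (\<integral>\<^sup>+u. ennreal (\<psi> u) * indicator {a..z - b} u * indicator {u<..} s \<partial>lborel) \<partial>P)"
    unfolding \<psi>_def using pos
    by (intro nn_integral_mono gaussian_tail_decomposition tail_B finite_measure_mono) auto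
  also have "\<dots> = ennreal (exp (- (\<beta> * (z - a)\<^sup>2)))
      + ennreal (1 - exp (- (\<beta> * b\<^sup>2))) * emeasure P {z - b<..}
      + (\<integral>\<^sup>+s. \<integral>\<^sup>+u. ennreal (\<psi> u) * indicator {a..z - b} u * indicator {u<..} s \<partial>lborel \<partial>P)"
  proof -
    have [measurable]: "(\<lambda>(s :: real, u). indicator {u<..} s :: ennreal) \<in> borel_measurable (borel \<Otimes>\<^sub>M borel)"
      unfolding indicator_def greaterThan_iff by measurable
    show ?thesis
      using P.emeasure_space_1 by (simp add: nn_integral_add nn_integral_cmult)
  qed
  \<comment> \<open>After exchanging the integrals the inner one is \<psi>(u) P(A > u), and the
    Gaussian tail bound of \<open>A\<close> gives an integrand with antiderivative \<Phi>.\<close>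
  also have "(\<integral>\<^sup>+s. \<integral>\<^sup>+u. ennreal (\<psi> u) * indicator {a..z - b} u * indicator {u<..} s \<partial>lborel \<partial>P) =
      (\<integral>\<^sup>+u. \<integral>\<^sup>+s. ennreal (\<psi> u) * indicator {a..z - b} u * indicator {u<..} s \<partial>P \<partial>lborel)"
    by (rule PL.Fubini'[symmetric]) (simp add: indicator_def)
  also have "\<dots> = (\<integral>\<^sup>+u. ennreal (\<psi> u) * indicator {a..z - b} u * emeasure P {u<..} \<partial>lborel)"
    by (intro nn_integral_cong) (simp add: nn_integral_cmult)
  also have "\<dots> \<le> (\<integral>\<^sup>+u. ennreal (exp (- (\<alpha> * u\<^sup>2)) * \<psi> u) * indicator {a..z - b} u \<partial>lborel)"
  proof (rule nn_integral_mono)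
    fix u
    show "ennreal (\<psi> u) * indicator {a..z - b} u * emeasure P {u<..} \<le>
        ennreal (exp (- (\<alpha> * u\<^sup>2)) * \<psi> u) * indicator {a..z - b} u"
    proof (cases "u \<in> {a..z - b}")
      case True
      then have "0 \<le> \<psi> u" using pos by (simp add: \<psi>_def)
      moreover have "prob {\<omega> \<in> space M. u < A \<omega>} \<le> exp (- (\<alpha> * u\<^sup>2))" using True by (intro tail_A) simp
      ultimately have "ennreal (\<psi> u * prob {\<omega> \<in> space M. u < A \<omega>}) \<le> ennreal (\<psi> u * exp (- (\<alpha> * u\<^sup>2)))"
        by (intro ennreal_leI mult_left_mono)
      then show ?thesis using True \<open>0 \<le> \<psi> u\<close> by (simp add: P_tail ennreal_mult mult.commute)
    qed simp
  qed
  also have "\<dots> = ennreal (\<Phi> (z - b) - \<Phi> a)"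
    using pos \<Phi> by (intro nn_integral_FTC_Icc) (auto simp: \<psi>_def)
  also have "ennreal (1 - exp (- (\<beta> * b\<^sup>2))) * emeasure P {z - b<..} \<le>
      ennreal ((1 - exp (- (\<beta> * b\<^sup>2))) * exp (- (\<alpha> * (z - b)\<^sup>2)))"
    using pos tail_A[of "z - b"] unfolding P_tail
    by (subst ennreal_mult[symmetric]) (auto intro!: ennreal_leI mult_left_mono)
  finally have "ennreal (prob {\<omega> \<in> space M. z < A \<omega> + B \<omega>}) \<le> ennreal (exp (- (\<beta> * (z - a)\<^sup>2)))
      + ennreal ((1 - exp (- (\<beta> * b\<^sup>2))) * exp (- (\<alpha> * (z - b)\<^sup>2))) + ennreal (\<Phi> (z - b) - \<Phi> a)"
    by (simp add: add_mono)
  moreover have "0 \<le> \<Phi> (z - b) - \<Phi> a"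
  proof -
    have "\<Phi> a \<le> \<Phi> (z - b)"
      using \<Phi> by (rule deriv_nonneg_imp_mono) (use pos in auto)
    then show ?thesis by simp
  qed
  moreover have "0 \<le> (1 - exp (- (\<beta> * b\<^sup>2))) * exp (- (\<alpha> * (z - b)\<^sup>2))"
    using pos by simp
  ultimately show ?thesis
    by (simp add: ennreal_plus[symmetric] del: ennreal_plus)
qed

section \<open>The closed form of the convolution bound\<close>

lemma powr_three_halves:
  fixes x :: real assumes "0 < x" shows "x powr (3 / 2) = x * sqrt x"
proof -
  have "x powr (3 / 2) = x powr (1 + 1 / 2)" by simp
  also have "\<dots> = x * sqrt x" using assms by (subst powr_add) (simp add: powr_half_sqrt)
  finally show ?thesis .
qed

text \<open>The power of 2 and the linear term in the exponent of \<open>C\<close> are what remains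
  of exp (-\<beta> (z - a)^2) with a = sqrt (ln 2 / (2 n)): here \<beta> a^2 = (m/n) ln 2 and 2 a =
  sqrt (ln 4 / n).\<close>

lemma C_eq:
  fixes n m :: nat and z :: real
  assumes "n \<ge> 1" "m \<ge> 1" "0 \<le> z"
  defines "\<alpha> \<equiv> 2 * real n" and "\<beta> \<equiv> 2 * real m"
  shows "C n m z = (1 + real n / (real m + real n)) * exp (- (\<beta> * (z - sqrt (ln 2 / (2 * real n)))\<^sup>2))
    + 2 * (sqrt pi * \<alpha> * \<beta> * z / ((\<alpha> + \<beta>) * sqrt (\<alpha> + \<beta>)) * exp (- (\<alpha> * \<beta> * z\<^sup>2 / (\<alpha> + \<beta>)))) *
      erf (sqrt (\<alpha> + \<beta>) * (\<beta> * z / (\<alpha> + \<beta>) - sqrt (ln 2 / (2 * real n))))"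
proof -
  define a where "a = sqrt (ln 2 / (2 * real n))"
  have nm: "0 < real n" "0 < real m" using assms by auto
  define s where "s = real m + real n"
  have s: "0 < s" using nm by (simp add: s_def)
  have ab: "\<alpha> + \<beta> = 2 * s" by (simp add: \<alpha>_def \<beta>_def s_def)
  have a2: "a\<^sup>2 = ln 2 / (2 * real n)" by (simp add: a_def)
  have "sqrt (ln 4 / real n) = 2 * a"
  proof (rule real_sqrt_unique)
    have "ln 4 = 2 * ln (2 :: real)" using ln_realpow[of 2 2] by simp
    then show "(2 * a)\<^sup>2 = ln 4 / real n" by (simp add: power_mult_distrib a2)
  qed (simp add: a_def)
  then have "2 powr (- (real m / real n)) * exp (- 2 * real m * z * (z - sqrt (ln 4 / real n))) =
      exp (- (real m / real n) * ln 2 - 2 * real m * z * (z - 2 * a))"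
    by (simp add: powr_def exp_add[symmetric] exp_diff[symmetric])
  also have "- (real m / real n) * ln 2 - 2 * real m * z * (z - 2 * a) = - (\<beta> * (z - a)\<^sup>2)"
  proof -
    have "\<beta> * a\<^sup>2 = real m / real n * ln 2" by (simp add: a2 \<beta>_def)
    then show ?thesis by (simp add: \<beta>_def power2_diff algebra_simps power2_eq_square)
  qed
  finally have 1: "2 powr (- (real m / real n)) * exp (- 2 * real m * z * (z - sqrt (ln 4 / real n))) =
      exp (- (\<beta> * (z - a)\<^sup>2))" .
  have sqrt2s: "sqrt (2 * s) = sqrt 2 * sqrt s" by (rule real_sqrt_mult)
  have "2 * (sqrt pi * \<alpha> * \<beta> * z / (2 * s * (sqrt 2 * sqrt s))) =
      4 / sqrt 2 * (sqrt pi * z * (real m * real n / (s * sqrt s)))"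
    using s by (simp add: \<alpha>_def \<beta>_def mult_ac)
  also have "4 / sqrt 2 * (sqrt pi * z * (real m * real n / (s * sqrt s))) =
      sqrt (8 * pi) * z * (real m * real n / s powr (3 / 2))"
  proof -
    have "4 / sqrt 2 = sqrt (8 :: real)"
    proof (rule real_sqrt_unique[symmetric])
      show "(4 / sqrt 2)\<^sup>2 = (8 :: real)" by (simp add: power_divide)
    qed simp
    then show ?thesis using s by (simp add: real_sqrt_mult powr_three_halves)
  qed
  finally have 2: "2 * (sqrt pi * \<alpha> * \<beta> * z / ((\<alpha> + \<beta>) * sqrt (\<alpha> + \<beta>))) =
      sqrt (8 * pi) * z * (real m * real n / s powr (3 / 2))"
    unfolding ab sqrt2s .
  have 3: "\<alpha> * \<beta> * z\<^sup>2 / (\<alpha> + \<beta>) = 2 * real m * real n * z\<^sup>2 / s"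
    unfolding ab by (simp add: \<alpha>_def \<beta>_def)
  have 4: "sqrt (\<alpha> + \<beta>) * (\<beta> * z / (\<alpha> + \<beta>) - a) =
      sqrt (2 * (real m)\<^sup>2 * z\<^sup>2 / s) - sqrt (s * ln 2 / real n)"
  proof -
    have "sqrt (2 * (real m)\<^sup>2 * z\<^sup>2 / s) = sqrt (2 * s) * (\<beta> * z / (2 * s))"
    proof (rule real_sqrt_unique)
      show "(sqrt (2 * s) * (\<beta> * z / (2 * s)))\<^sup>2 = 2 * (real m)\<^sup>2 * z\<^sup>2 / s"
        using s by (simp add: power_mult_distrib power_divide \<beta>_def) (simp add: power2_eq_square)
    qed (use s assms nm in \<open>simp add: \<beta>_def\<close>)
    moreover have "sqrt (s * ln 2 / real n) = sqrt (2 * s) * a"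
      unfolding a_def real_sqrt_mult[symmetric] by simp
    ultimately show ?thesis unfolding ab by (simp add: right_diff_distrib)
  qed
  show ?thesis
    unfolding C_def a_def[symmetric] 4 3 mult.assoc[symmetric, of 2] 2
    unfolding s_def[symmetric] 1[symmetric] by simp
qed

lemma (in prob_space) gaussian_tail_sum_C:
  fixes n m :: nat and z :: real
  assumes indep: "indep_var borel A borel B"
    and nm: "n \<ge> 1" "m \<ge> 1"
    and z: "sqrt (ln 2 / (2 * real n)) + sqrt (ln 2 / (2 * real m)) \<le> z"
    and tail_A: "\<And>t. 0 \<le> t \<Longrightarrow> prob {\<omega> \<in> space M. t < A \<omega>} \<le> exp (- 2 * real n * t\<^sup>2)"
    and tail_B: "\<And>t. 0 \<le> t \<Longrightarrow> prob {\<omega> \<in> space M. t < B \<omega>} \<le> exp (- 2 * real m * t\<^sup>2)"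
  shows "prob {\<omega> \<in> space M. z < A \<omega> + B \<omega>} \<le> (C n m z + C m n z) / 2"
proof -
  define \<alpha> \<beta> where "\<alpha> = 2 * real n" and "\<beta> = 2 * real m"
  \<comment> \<open>The cut-offs are the points where the Gaussian bounds equal 1/2. The jump and
    the boundary values of \<Phi> thereby acquire factors 1/2.\<close>
  define a b where "a = sqrt (ln 2 / \<alpha>)" and "b = sqrt (ln 2 / \<beta>)"
  define \<sigma> where "\<sigma> = \<alpha> + \<beta>"
  have pos: "0 < \<alpha>" "0 < \<beta>" "0 < \<sigma>" using nm by (auto simp: \<alpha>_def \<beta>_def \<sigma>_def)
  have ab: "0 \<le> a" "0 \<le> b" "a + b \<le> z" "0 \<le> z"
    using z pos by (auto simp: a_def b_def \<alpha>_def \<beta>_def intro: order_trans[rotated])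
  have half: "exp (- (\<alpha> * a\<^sup>2)) = 1 / 2" "exp (- (\<beta> * b\<^sup>2)) = 1 / 2"
    using pos by (simp_all add: a_def b_def exp_minus)
  define \<kappa> where "\<kappa> = sqrt pi * \<alpha> * \<beta> * z / (\<sigma> * sqrt \<sigma>) * exp (- (\<alpha> * \<beta> * z\<^sup>2 / \<sigma>))"
  define \<Phi> where "\<Phi> u = \<beta> / \<sigma> * exp (- (\<alpha> * u\<^sup>2 + \<beta> * (z - u)\<^sup>2)) +
    \<kappa> * erf (sqrt \<sigma> * (u - \<beta> * z / \<sigma>))" for u
  define X Y where "X = exp (- (\<beta> * (z - a)\<^sup>2))" and "Y = exp (- (\<alpha> * (z - b)\<^sup>2))"
  define e1 e2 where "e1 = erf (sqrt \<sigma> * (\<alpha> * z / \<sigma> - b))" and "e2 = erf (sqrt \<sigma> * (\<beta> * z / \<sigma> - a))"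
  have "prob {\<omega> \<in> space M. z < A \<omega> + B \<omega>} \<le> exp (- (\<beta> * (z - a)\<^sup>2))
      + (1 - exp (- (\<beta> * b\<^sup>2))) * exp (- (\<alpha> * (z - b)\<^sup>2)) + (\<Phi> (z - b) - \<Phi> a)"
  proof (rule gaussian_tail_sum[OF indep pos(2) ab(2,3)])
    show "prob {\<omega> \<in> space M. t < A \<omega>} \<le> exp (- (\<alpha> * t\<^sup>2))" if "a \<le> t" for t
      using tail_A[of t] that ab(1) by (simp add: \<alpha>_def)
    show "prob {\<omega> \<in> space M. t < B \<omega>} \<le> exp (- (\<beta> * t\<^sup>2))" if "b \<le> t" for t
      using tail_B[of t] that ab(2) by (simp add: \<beta>_def)
    show "(\<Phi> has_real_derivative exp (- (\<alpha> * u\<^sup>2)) * (2 * \<beta> * (z - u) * exp (- (\<beta> * (z - u)\<^sup>2)))) (at u)" for u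
      unfolding \<Phi>_def \<kappa>_def \<sigma>_def using pos(1,2) by (rule gaussian_convolution_antiderivative)
  qed
  also have "\<dots> = X + Y / 2 + (\<Phi> (z - b) - \<Phi> a)" by (simp add: half X_def Y_def)
  also have "\<Phi> (z - b) = \<beta> / \<sigma> * (Y / 2) + \<kappa> * e1"
  proof -
    have "z - b - \<beta> * z / \<sigma> = \<alpha> * z / \<sigma> - b"
    proof -
      have "\<alpha> * z / \<sigma> + \<beta> * z / \<sigma> = z"
        using pos(3) by (simp add: add_divide_distrib[symmetric] distrib_right[symmetric] \<sigma>_def)
      then show ?thesis by linarith
    qed
    moreover have "exp (- (\<alpha> * (z - b)\<^sup>2 + \<beta> * b\<^sup>2)) = Y * exp (- (\<beta> * b\<^sup>2))"
      by (simp add: Y_def exp_add[symmetric])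
    moreover have "z - (z - b) = b" by simp
    ultimately show ?thesis by (simp only: \<Phi>_def e1_def half)
  qed
  also have "\<Phi> a = \<beta> / \<sigma> * (X / 2) - \<kappa> * e2"
  proof -
    have "sqrt \<sigma> * (a - \<beta> * z / \<sigma>) = - (sqrt \<sigma> * (\<beta> * z / \<sigma> - a))" by (simp add: algebra_simps)
    moreover have "exp (- (\<alpha> * a\<^sup>2 + \<beta> * (z - a)\<^sup>2)) = X * exp (- (\<alpha> * a\<^sup>2))"
      by (simp add: X_def exp_add[symmetric])
    ultimately show ?thesis by (simp only: \<Phi>_def e2_def half erf_minus)
  qed
  \<comment> \<open>Since \<beta>/\<sigma> = 1 - \<alpha>/\<sigma>, the coefficient 1 -
    \<beta>/(2\<sigma>) of \<open>X\<close> is (1 + \<alpha>/\<sigma>)/2. Oddness of the error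
    function made the lower endpoint contribute + \<open>e2\<close>, so the expression is symmetric
    in the two samples.\<close>
  also have "X + Y / 2 + (\<beta> / \<sigma> * (Y / 2) + \<kappa> * e1 - (\<beta> / \<sigma> * (X / 2) - \<kappa> * e2)) =
      (((1 + \<alpha> / \<sigma>) * X + 2 * \<kappa> * e2) + ((1 + \<beta> / \<sigma>) * Y + 2 * \<kappa> * e1)) / 2"
  proof -
    obtain q where q: "\<alpha> / \<sigma> = q" by blast
    moreover have "\<beta> / \<sigma> = 1 - \<alpha> / \<sigma>" using pos(3) by (simp add: field_simps \<sigma>_def)
    ultimately have "\<beta> / \<sigma> = 1 - q" by simp
    show ?thesis unfolding q \<open>\<beta> / \<sigma> = 1 - q\<close> by (simp add: field_simps)
  qed
  also have "(1 + \<alpha> / \<sigma>) * X + 2 * \<kappa> * e2 = C n m z"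
  proof -
    have "\<alpha> / \<sigma> = real n / (real m + real n)"
      using nm by (simp add: \<alpha>_def \<beta>_def \<sigma>_def divide_simps) (simp add: algebra_simps)?
    then show ?thesis
      unfolding C_eq[OF nm ab(4)] X_def \<kappa>_def e2_def a_def \<sigma>_def \<alpha>_def \<beta>_def by simp
  qed
  also have "(1 + \<beta> / \<sigma>) * Y + 2 * \<kappa> * e1 = C m n z"
  proof -
    have "\<beta> / \<sigma> = real m / (real n + real m)"
      using nm by (simp add: \<alpha>_def \<beta>_def \<sigma>_def divide_simps) (simp add: algebra_simps)?
    then show ?thesis
      unfolding C_eq[OF nm(2,1) ab(4)] Y_def \<kappa>_def e1_def b_def \<sigma>_def \<alpha>_def \<beta>_def
      by (simp add: ac_simps)
  qed
  finally show ?thesis .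
qed

text \<open>For equal sample sizes the two terms of the bound coincide, hence the factor 2. With r =
  sqrt (2/n) the relation n r^2 = 2 removes every occurrence of \<open>n\<close>.\<close>

lemma C_equal_sizes:
  fixes n :: nat and z :: real
  assumes n: "n \<ge> 1" and z: "0 \<le> z"
  shows "2 * C n n (z * sqrt (2 / real n)) =
    3 / 2 * exp (- 4 * z * (z - sqrt (ln 2))) + sqrt (8 * pi) * z * exp (- 2 * z\<^sup>2) * erf (sqrt 2 * (z - sqrt (ln 2)))"
proof -
  define r where "r = sqrt (2 / real n)"
  have n0: "0 < real n" using n by simp
  have r2: "r * r = 2 / real n" by (simp add: r_def)
  have nr: "real n * (r * r) = 2" using n0 by (simp add: r2)
  have "sqrt (ln 4 / real n) = r * sqrt (ln 2)"
  proof -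
    have "ln 4 = 2 * ln (2 :: real)" using ln_realpow[of 2 2] by simp
    then show ?thesis by (simp add: r_def real_sqrt_mult[symmetric])
  qed
  then have 1: "- 2 * real n * (z * r) * (z * r - sqrt (ln 4 / real n)) = - 4 * z * (z - sqrt (ln 2))"
  proof -
    have "- 2 * real n * (z * r) * (z * r - r * sqrt (ln 2)) =
        - 2 * (real n * (r * r)) * z * (z - sqrt (ln 2))" by (simp add: algebra_simps)
    then show ?thesis using \<open>sqrt (ln 4 / real n) = r * sqrt (ln 2)\<close> unfolding nr by simp
  qed
  have 2: "2 * real n * real n * (z * r)\<^sup>2 / (real n + real n) = 2 * z\<^sup>2"
  proof -
    have "2 * real n * real n * (z * r)\<^sup>2 / (real n + real n) = real n * (r * r) * z\<^sup>2"
      using n0 by (simp add: power2_eq_square)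
    then show ?thesis by (simp only: nr)
  qed
  have 3: "sqrt (2 * (real n)\<^sup>2 * (z * r)\<^sup>2 / (real n + real n)) - sqrt ((real n + real n) * ln 2 / real n) =
      sqrt 2 * (z - sqrt (ln 2))"
  proof -
    have "2 * (real n)\<^sup>2 * (z * r)\<^sup>2 / (real n + real n) = 2 * z\<^sup>2"
      using 2 by (simp add: power2_eq_square)
    moreover have "(real n + real n) * ln 2 / real n = 2 * ln 2" using n0 by simp
    ultimately show ?thesis using z by (simp add: real_sqrt_mult right_diff_distrib)
  qed
  have 4: "2 * (z * r * (real n * real n / (real n + real n) powr (3 / 2))) = z"
  proof -
    have "(real n + real n) powr (3 / 2) = 2 * real n * sqrt (2 * real n)"
      using n0 powr_three_halves[of "real n + real n"] by simp
    moreover have "r * real n = sqrt (2 * real n)"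
    proof (rule real_sqrt_unique[symmetric])
      show "(r * real n)\<^sup>2 = 2 * real n" using nr by (simp add: power2_eq_square ac_simps)
    qed (simp add: r_def)
    ultimately show ?thesis using n0 by (simp add: field_simps)
  qed
  have 5: "1 + real n / (real n + real n) = 3 / 2" "2 powr (- (real n / real n)) = 1 / 2"
    using n0 by (simp_all add: powr_minus_divide)
  have "2 * C n n (z * r) = 3 / 2 * exp (- 4 * z * (z - sqrt (ln 2))) +
      sqrt (8 * pi) * (2 * (z * r * (real n * real n / (real n + real n) powr (3 / 2)))) *
        exp (- (2 * z\<^sup>2)) * erf (sqrt 2 * (z - sqrt (ln 2)))"
    unfolding C_def 1 2 3 5 by (simp add: algebra_simps)
  from this[unfolded 4] show ?thesis by (simp add: r_def)
qed

section \<open>The two-sample statistic\<close>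

text \<open>The reverse triangle inequality for the supremum norm. The bounds by 1 ensure that the
  real suprema are taken over bounded sets.\<close>

lemma ks_dist_diff_le:
  assumes "\<And>x. \<bar>A x - B x\<bar> \<le> 1" "\<And>x. \<bar>A' x - B' x\<bar> \<le> 1"
    and "\<And>x. \<bar>(A x - B x) - (A' x - B' x)\<bar> \<le> \<delta>"
  shows "\<bar>ks_dist A B - ks_dist A' B'\<bar> \<le> \<delta>"
proof -
  have le: "ks_dist A B \<le> ks_dist A' B' + \<delta>"
    if "\<And>x. \<bar>A' x - B' x\<bar> \<le> 1" "\<And>x. \<bar>(A x - B x) - (A' x - B' x)\<bar> \<le> \<delta>" for A B A' B' :: "real \<Rightarrow> real"
    unfolding ks_dist_def
  proof (rule cSUP_least)
    fix x
    have "bdd_above (range (\<lambda>x. \<bar>A' x - B' x\<bar>))" using that(1) by (intro bdd_aboveI[of _ 1]) auto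
    then have "\<bar>A' x - B' x\<bar> \<le> (SUP x. \<bar>A' x - B' x\<bar>)" by (rule cSUP_upper[OF UNIV_I])
    then show "\<bar>A x - B x\<bar> \<le> (SUP x. \<bar>A' x - B' x\<bar>) + \<delta>" using that(2)[of x] by linarith
  qed simp
  have "ks_dist A B \<le> ks_dist A' B' + \<delta>" by (rule le) fact+
  moreover have "ks_dist A' B' \<le> ks_dist A B + \<delta>"
  proof (rule le)
    show "\<bar>(A' x - B' x) - (A x - B x)\<bar> \<le> \<delta>" for x using assms(3)[of x] by linarith
  qed fact
  ultimately show ?thesis by linarith
qed

text \<open>Independence is stated for the sample vectors restricted to their index sets; this lets
  the excess be evaluated on the restrictions.\<close>

lemma ecdf_excess_cong:
  assumes "\<And>i. i \<in> {1..n} \<Longrightarrow> xs i = ys i"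
  shows "ecdf_excess n F xs = ecdf_excess n F ys"
proof -
  have "ecdf n xs x = ecdf n ys x" for x
    using assms by (simp add: ecdf_def)
  then show ?thesis using assms by (simp add: ecdf_excess_def cong: image_cong_simp)
qed

text \<open>Each of \<phi> and \<psi> is later the identity or the reflection, which gives the
  excess of one sample paired with the deficit of the other.\<close>

lemma indep_var_ecdf_excess:
  assumes M: "prob_space M" and indep: "indep_samples M n X m Y"
    and [measurable]: "F \<in> borel_measurable borel" "G \<in> borel_measurable borel"
      "\<phi> \<in> borel_measurable borel" "\<psi> \<in> borel_measurable borel"
  shows "prob_space.indep_var M borel (\<lambda>\<omega>. ecdf_excess n F (\<lambda>i. \<phi> (X i \<omega>)))
    borel (\<lambda>\<omega>. ecdf_excess m G (\<lambda>j. \<psi> (Y j \<omega>)))"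
proof -
  interpret prob_space M by fact
  have "indep_var borel ((\<lambda>v. ecdf_excess n F (\<lambda>i. \<phi> (v i))) \<circ> (\<lambda>\<omega>. \<lambda>i\<in>{1..n}. X i \<omega>))
    borel ((\<lambda>v. ecdf_excess m G (\<lambda>j. \<psi> (v j))) \<circ> (\<lambda>\<omega>. \<lambda>j\<in>{1..m}. Y j \<omega>))"
    using indep unfolding indep_samples_def
    by (rule indep_var_compose) (intro ecdf_excess_measurable; measurable)+
  moreover have "(\<lambda>v. ecdf_excess n F (\<lambda>i. \<phi> (v i))) \<circ> (\<lambda>\<omega>. \<lambda>i\<in>{1..n}. X i \<omega>) =
      (\<lambda>\<omega>. ecdf_excess n F (\<lambda>i. \<phi> (X i \<omega>)))"
    by (intro ext) (auto intro!: ecdf_excess_cong)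
  moreover have "(\<lambda>v. ecdf_excess m G (\<lambda>j. \<psi> (v j))) \<circ> (\<lambda>\<omega>. \<lambda>j\<in>{1..m}. Y j \<omega>) =
      (\<lambda>\<omega>. ecdf_excess m G (\<lambda>j. \<psi> (Y j \<omega>)))"
    by (intro ext) (auto intro!: ecdf_excess_cong)
  ultimately show ?thesis by simp
qed

lemma is_cdfD:
  assumes "is_cdf F"
  shows "mono F" "\<And>x. 0 \<le> F x" "\<And>x. F x \<le> 1"
proof -
  obtain \<mu> where "real_distribution \<mu>" and F: "F = cdf \<mu>" using assms by (auto simp: is_cdf_def)
  then interpret real_distribution \<mu> by simp
  show "mono F" "\<And>x. 0 \<le> F x" "\<And>x. F x \<le> 1"
    unfolding F by (auto simp: mono_def intro: cdf_nondecreasing cdf_nonneg cdf_bounded_prob)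
qed

lemma two_sample_ks_tail:
  assumes M: "prob_space M"
    and F: "is_cdf F" "continuous_on UNIV F" and G: "is_cdf G" "continuous_on UNIV G"
    and nm: "n \<ge> 1" "m \<ge> 1"
    and X: "iid_sample M n X F" and Y: "iid_sample M m Y G" and indep: "indep_samples M n X m Y"
    and z: "sqrt (ln 2 / (2 * real n)) + sqrt (ln 2 / (2 * real m)) \<le> z"
  shows "measure M {\<omega> \<in> space M.
    \<bar>ks_dist (ecdf n (\<lambda>i. X i \<omega>)) (ecdf m (\<lambda>j. Y j \<omega>)) - ks_dist F G\<bar> > z} \<le> C n m z + C m n z"
proof -
  interpret prob_space M by fact
  note FD = is_cdfD[OF F(1)] and GD = is_cdfD[OF G(1)]
  define F' G' where "F' = (\<lambda>x. 1 - F (- x))" and "G' = (\<lambda>x. 1 - G (- x))"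
  have cont': "continuous_on UNIV F'" "continuous_on UNIV G'"
    unfolding F'_def G'_def
    by (intro continuous_intros continuous_on_compose2[OF F(2)] continuous_on_compose2[OF G(2)]; simp)+
  have meas: "F \<in> borel_measurable borel" "G \<in> borel_measurable borel"
      "F' \<in> borel_measurable borel" "G' \<in> borel_measurable borel"
    using F(2) G(2) cont' by (auto intro: borel_measurable_continuous_onI)
  define A where "A \<omega> = ecdf_excess n F (\<lambda>i. X i \<omega>)" for \<omega>
  define A' where "A' \<omega> = ecdf_excess n F' (\<lambda>i. - X i \<omega>)" for \<omega>
  define B where "B \<omega> = ecdf_excess m G (\<lambda>i. Y i \<omega>)" for \<omega>
  define B' where "B' \<omega> = ecdf_excess m G' (\<lambda>i. - Y i \<omega>)" for \<omega>
  have indep_AB: "indep_var borel A borel B'" "indep_var borel A' borel B"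
    using indep_var_ecdf_excess[OF M indep meas(1) meas(4), of "\<lambda>x. x" uminus]
      indep_var_ecdf_excess[OF M indep meas(3) meas(2), of uminus "\<lambda>x. x"]
    by (simp_all add: A_def[abs_def] B_def[abs_def] A'_def[abs_def] B'_def[abs_def])
  note [measurable] = indep_AB[THEN indep_var_rv1] indep_AB[THEN indep_var_rv2]
  note X' = iid_sample_uminus[OF M X F(2), folded F'_def]
  note Y' = iid_sample_uminus[OF M Y G(2), folded G'_def]
  have AB': "prob {\<omega> \<in> space M. z < A \<omega> + B' \<omega>} \<le> (C n m z + C m n z) / 2"
    using dkw_one_sided[OF M X F(2) nm(1)] dkw_one_sided[OF M Y' cont'(2) nm(2)]
    by (intro gaussian_tail_sum_C[OF indep_AB(1) nm z]) (auto simp: A_def B'_def)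
  have A'B: "prob {\<omega> \<in> space M. z < A' \<omega> + B \<omega>} \<le> (C n m z + C m n z) / 2"
    using dkw_one_sided[OF M X' cont'(1) nm(1)] dkw_one_sided[OF M Y G(2) nm(2)]
    by (intro gaussian_tail_sum_C[OF indep_AB(2) nm z]) (auto simp: A'_def B_def)
  have "prob {\<omega> \<in> space M.
      \<bar>ks_dist (ecdf n (\<lambda>i. X i \<omega>)) (ecdf m (\<lambda>j. Y j \<omega>)) - ks_dist F G\<bar> > z} \<le>
    prob ({\<omega> \<in> space M. z < A \<omega> + B' \<omega>} \<union> {\<omega> \<in> space M. z < A' \<omega> + B \<omega>})"
  \<comment> \<open>Monotonicity asks for measurability of the larger event, which is built from
    measurable excesses; the suprema over all reals stay on the smaller side.\<close>
  proof (rule finite_measure_mono)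
    show "{\<omega> \<in> space M. \<bar>ks_dist (ecdf n (\<lambda>i. X i \<omega>)) (ecdf m (\<lambda>j. Y j \<omega>)) - ks_dist F G\<bar> > z} \<subseteq>
      {\<omega> \<in> space M. z < A \<omega> + B' \<omega>} \<union> {\<omega> \<in> space M. z < A' \<omega> + B \<omega>}"
    proof
      fix \<omega> assume \<omega>: "\<omega> \<in> {\<omega> \<in> space M. \<bar>ks_dist (ecdf n (\<lambda>i. X i \<omega>)) (ecdf m (\<lambda>j. Y j \<omega>)) - ks_dist F G\<bar> > z}"
      have "\<bar>ks_dist (ecdf n (\<lambda>i. X i \<omega>)) (ecdf m (\<lambda>j. Y j \<omega>)) - ks_dist F G\<bar> \<le> max (A \<omega> + B' \<omega>) (A' \<omega> + B \<omega>)"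
      \<comment> \<open>(F_n - F) - (G_m - G) is at most A + B' from above, and its negative is at
        most A' + B. Both sums pair one variable from each sample, so each has independent
        summands.\<close>
      proof (rule ks_dist_diff_le)
        fix x
        show "\<bar>ecdf n (\<lambda>i. X i \<omega>) x - ecdf m (\<lambda>j. Y j \<omega>) x\<bar> \<le> 1"
          using ecdf_nonneg[of n "\<lambda>i. X i \<omega>" x] ecdf_nonneg[of m "\<lambda>i. Y i \<omega>" x]
            ecdf_le_1[of n "\<lambda>i. X i \<omega>" x] ecdf_le_1[of m "\<lambda>i. Y i \<omega>" x] by linarith
        show "\<bar>F x - G x\<bar> \<le> 1" using FD(2,3)[of x] GD(2,3)[of x] by linarith
        have "ecdf n (\<lambda>i. X i \<omega>) x - F x \<le> A \<omega>" unfolding A_def by (intro ecdf_diff_le_excess FD)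
        moreover have "F x - ecdf n (\<lambda>i. X i \<omega>) x \<le> A' \<omega>"
          unfolding A'_def F'_def by (intro ecdf_deficit_le_excess_uminus FD nm)
        moreover have "ecdf m (\<lambda>i. Y i \<omega>) x - G x \<le> B \<omega>" unfolding B_def by (intro ecdf_diff_le_excess GD)
        moreover have "G x - ecdf m (\<lambda>i. Y i \<omega>) x \<le> B' \<omega>"
          unfolding B'_def G'_def by (intro ecdf_deficit_le_excess_uminus GD nm)
        ultimately show "\<bar>(ecdf n (\<lambda>i. X i \<omega>) x - ecdf m (\<lambda>j. Y j \<omega>) x) - (F x - G x)\<bar> \<le>
            max (A \<omega> + B' \<omega>) (A' \<omega> + B \<omega>)" by linarith
      qed
      then show "\<omega> \<in> {\<omega> \<in> space M. z < A \<omega> + B' \<omega>} \<union> {\<omega> \<in> space M. z < A' \<omega> + B \<omega>}"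
        using \<omega> by auto
    qed
  qed measurable
  also have "\<dots> \<le> prob {\<omega> \<in> space M. z < A \<omega> + B' \<omega>} + prob {\<omega> \<in> space M. z < A' \<omega> + B \<omega>}"
    by (rule measure_Un_le) measurable
  also have "\<dots> \<le> (C n m z + C m n z) / 2 + (C n m z + C m n z) / 2"
    using AB' A'B by (rule add_mono)
  also have "\<dots> = C n m z + C m n z" by simp
  finally show ?thesis .
qed

lemma sqrt_div_eq_powr:
  fixes n :: nat assumes "n \<ge> 1"
  shows "sqrt (ln 2 / (2 * real n)) = sqrt (ln 2 / 2) * real n powr (- 1 / 2)"
proof -
  have "real n powr (- 1 / 2) = 1 / sqrt (real n)"
    using assms powr_minus_divide[of "real n" "1 / 2"] by (simp add: powr_half_sqrt)
  then show ?thesis by (simp add: real_sqrt_divide real_sqrt_mult)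
qed

theorem mainTheorem3:
  fixes M :: "'a measure" and F G :: "real \<Rightarrow> real"
    and X Y :: "nat \<Rightarrow> 'a \<Rightarrow> real" and n m :: nat
  assumes "prob_space M"
    and "is_cdf F" and "continuous_on UNIV F"
    and "is_cdf G" and "continuous_on UNIV G"
    and "n \<ge> 1" and "m \<ge> 1"
    and "iid_sample M n X F" and "iid_sample M m Y G"
    and "indep_samples M n X m Y"
  shows "(\<forall>z::real. z \<ge> sqrt (ln 2 / 2) * (real n powr (- 1 / 2) + real m powr (- 1 / 2)) \<longrightarrow>
            measure M {\<omega> \<in> space M.
                \<bar>ks_dist (ecdf n (\<lambda>i. X i \<omega>)) (ecdf m (\<lambda>j. Y j \<omega>)) - ks_dist F G\<bar> > z}
              \<le> min 1 (C n m z + C m n z))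
       \<and> (n = m \<longrightarrow> (\<forall>z::real. z \<ge> sqrt (ln 2) \<longrightarrow>
            measure M {\<omega> \<in> space M.
                sqrt (real n / 2) *
                  \<bar>ks_dist (ecdf n (\<lambda>i. X i \<omega>)) (ecdf n (\<lambda>j. Y j \<omega>)) - ks_dist F G\<bar> > z}
              \<le> \<alpha>\<^sub>2 z))"
proof (intro conjI impI allI)
  fix z :: real
  assume z: "sqrt (ln 2 / 2) * (real n powr (- 1 / 2) + real m powr (- 1 / 2)) \<le> z"
  have "sqrt (ln 2 / (2 * real n)) + sqrt (ln 2 / (2 * real m)) \<le> z"
    using z assms(6,7) by (simp only: sqrt_div_eq_powr distrib_left)
  then show "measure M {\<omega> \<in> space M.
      \<bar>ks_dist (ecdf n (\<lambda>i. X i \<omega>)) (ecdf m (\<lambda>j. Y j \<omega>)) - ks_dist F G\<bar> > z} \<le> min 1 (C n m z + C m n z)"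
    using two_sample_ks_tail[OF assms] prob_space.prob_le_1[OF assms(1)] by simp
next
  fix z :: real
  assume "n = m" and z: "sqrt (ln 2) \<le> z"
  \<comment> \<open>\<open>r\<close> is the inverse of the normalising factor: the rescaled event at
    level z is the plain event at level z r, and the threshold on z r in the general bound becomes z
    \<ge> sqrt (ln 2).\<close>
  define r where "r = sqrt (2 / real n)"
  have n0: "0 < real n" using assms(6) by simp
  have r: "0 < r" "sqrt (real n / 2) * r = 1"
    using n0 by (simp_all add: r_def real_sqrt_mult[symmetric])
  have "sqrt (ln 2 / (2 * real n)) + sqrt (ln 2 / (2 * real n)) = r * sqrt (ln 2)"
  proof -
    have "r * sqrt (ln 2) = sqrt (4 * (ln 2 / (2 * real n)))"
      unfolding r_def real_sqrt_mult[symmetric] using n0 by (simp add: field_simps)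
    also have "\<dots> = 2 * sqrt (ln 2 / (2 * real n))" by (subst real_sqrt_mult) simp
    finally show ?thesis by simp
  qed
  also have "\<dots> \<le> z * r" using z r(1) by (simp add: mult.commute mult_left_mono)
  finally have "measure M {\<omega> \<in> space M.
      \<bar>ks_dist (ecdf n (\<lambda>i. X i \<omega>)) (ecdf n (\<lambda>j. Y j \<omega>)) - ks_dist F G\<bar> > z * r} \<le> 2 * C n n (z * r)"
    using two_sample_ks_tail[OF assms, of "z * r"] \<open>n = m\<close> by simp
  moreover have "z < sqrt (real n / 2) * d \<longleftrightarrow> z * r < d" for d
  proof -
    have "z < sqrt (real n / 2) * d \<longleftrightarrow> z * r < sqrt (real n / 2) * d * r"
      using r(1) by simp
    also have "sqrt (real n / 2) * d * r = d" using r(2) by (simp add: ac_simps)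
    finally show ?thesis .
  qed
  moreover have "0 \<le> z" using z by (rule order_trans[rotated]) simp
  ultimately show "measure M {\<omega> \<in> space M. sqrt (real n / 2) *
      \<bar>ks_dist (ecdf n (\<lambda>i. X i \<omega>)) (ecdf n (\<lambda>j. Y j \<omega>)) - ks_dist F G\<bar> > z} \<le> \<alpha>\<^sub>2 z"
    using C_equal_sizes[OF assms(6), of z] prob_space.prob_le_1[OF assms(1)]
    by (simp add: \<alpha>\<^sub>2_def r_def)
qed

end
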